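(* Let $a,b,c,d\in\mathbb{R}$ with $a^2+c^2\neq0$, $b^2+d^2\neq0$ and $ad-bc\neq0$, and let $\mathfrak{g}_{a,b,c,d}$ be the $7$-dimensional real Lie algebra with basis $\{e_1,\ldots,e_7\}$ and nonzero brackets $$[e_1,e_4]=ae_5,\ [e_1,e_5]=-ae_4,\ [e_1,e_6]=be_7,\ [e_1,e_7]=-be_6,$$ $$[e_2,e_4]=ce_5,\ [e_2,e_5]=-ce_4,\ [e_2,e_6]=de_7,\ [e_2,e_7]=-de_6.$$ Let $\varphi=e^{123}+e^{145}+e^{167}+e^{246}-e^{257}-e^{347}-e^{356}\in\bigwedge^3\mathfrak{g}_{a,b,c,d}^*$. Then $\varphi$ is coclosed if and only if $c=-d$.
   Context: $\{e^i\}$ is the dual basis and $e^{ijk}=e^i\wedge e^j\wedge e^k$. $d$ applied to forms is the Chevalley–Eilenberg differential (not to be confused with the real parameter $d$). The $3$-form $\varphi$ is a $G_2$-structure on the Lie algebra: it induces the inner product for which $\{e_i\}$ is orthonormal and the volume form $e^{1\cdots7}$; $\star_\varphi$ is the corresponding Hodge star. $\varphi$ is coclosed if the Chevalley–Eilenberg differential of $\star_\varphi\varphi$ vanishes. *)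

theory Defs
  imports "HOL-Analysis.Analysis"
begin

section \<open>Real Lie algebras and bases of length 7\<close>

definition lie_algebra :: "('a::real_vector \<Rightarrow> 'a \<Rightarrow> 'a) \<Rightarrow> bool" where
  "lie_algebra br \<longleftrightarrow>
     bilinear br \<and> (\<forall>x. br x x = 0) \<and>
     (\<forall>x y z. br x (br y z) + br y (br z x) + br z (br x y) = 0)"

definition frame :: "(nat \<Rightarrow> 'a::real_vector) \<Rightarrow> bool" where
  "frame e \<longleftrightarrow> inj_on e {1..7} \<and> independent (e ` {1..7}) \<and> span (e ` {1..7}) = UNIV"

definition lie_algebra_g ::
  "real \<Rightarrow> real \<Rightarrow> real \<Rightarrow> real \<Rightarrow> ('a::real_vector \<Rightarrow> 'a \<Rightarrow> 'a) \<Rightarrow> (nat \<Rightarrow> 'a) \<Rightarrow> bool" where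
  "lie_algebra_g a b c d br e \<longleftrightarrow>
     lie_algebra br \<and> frame e \<and>
     br (e 1) (e 4) = a *\<^sub>R e 5 \<and> br (e 1) (e 5) = - a *\<^sub>R e 4 \<and>
     br (e 1) (e 6) = b *\<^sub>R e 7 \<and> br (e 1) (e 7) = - b *\<^sub>R e 6 \<and>
     br (e 2) (e 4) = c *\<^sub>R e 5 \<and> br (e 2) (e 5) = - c *\<^sub>R e 4 \<and>
     br (e 2) (e 6) = d *\<^sub>R e 7 \<and> br (e 2) (e 7) = - d *\<^sub>R e 6 \<and>
     (\<forall>i\<in>{1..7}. \<forall>j\<in>{1..7}. i < j \<and> (i, j) \<notin> {1, 2} \<times> {4..7} \<longrightarrow> br (e i) (e j) = 0)"


section \<open>Exterior forms\<close>

text \<open>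
  A form takes the list of its arguments and vanishes on lists whose length is not its degree.
  The degree is thus implicit in operations such as the wedge product.
\<close>

type_synonym 'a form = "'a list \<Rightarrow> real"

definition is_form :: "nat \<Rightarrow> 'a::real_vector form \<Rightarrow> bool" where
  "is_form k \<omega> \<longleftrightarrow>
     (\<forall>xs. length xs \<noteq> k \<longrightarrow> \<omega> xs = 0) \<and>
     (\<forall>xs ys. length xs + 1 + length ys = k \<longrightarrow> linear (\<lambda>v. \<omega> (xs @ v # ys))) \<and>
     (\<forall>xs. \<not> distinct xs \<longrightarrow> \<omega> xs = 0)"

text \<open>
  The wedge product is the signed sum over shuffles (no factorial prefactor), so that
  \<open>e\<^sup>i \<and> e\<^sup>j\<close> takes the value 1 on \<open>(e\<^sub>i, e\<^sub>j)\<close>. The index set \<open>I\<close> holds the positions of the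
  arguments that go to the first factor; subsets of the wrong size contribute 0.
\<close>

definition shuffle_sign :: "nat \<Rightarrow> nat set \<Rightarrow> real" where
  "shuffle_sign n I = (-1) ^ card {(i, j). i \<in> I \<and> j \<in> {..<n} - I \<and> j < i}"

definition wedge :: "'a form \<Rightarrow> 'a form \<Rightarrow> 'a form" where
  "wedge \<alpha> \<beta> xs =
     (\<Sum>I\<in>Pow {..<length xs}. shuffle_sign (length xs) I * \<alpha> (nths xs I) * \<beta> (nths xs (- I)))"

definition unit_form :: "'a form" where
  "unit_form xs = (if xs = [] then 1 else 0)"

definition dual_form :: "(nat \<Rightarrow> 'a::real_vector) \<Rightarrow> nat \<Rightarrow> 'a form" where
  "dual_form e i xs = (case xs of [x] \<Rightarrow> representation (e ` {1..7}) x (e i) | _ \<Rightarrow> 0)"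

text \<open>\<open>coframe e [i, j, k]\<close> is \<open>e\<^sup>i \<and> e\<^sup>j \<and> e\<^sup>k\<close>.\<close>

definition coframe :: "(nat \<Rightarrow> 'a::real_vector) \<Rightarrow> nat list \<Rightarrow> 'a form" where
  "coframe e is = foldr (\<lambda>i. wedge (dual_form e i)) is unit_form"

definition interior :: "'a \<Rightarrow> 'a form \<Rightarrow> 'a form" where
  "interior X \<omega> xs = \<omega> (X # xs)"

text \<open>
  Chevalley--Eilenberg differential with trivial coefficients:
  \<open>(d\<omega>)(x\<^sub>0, \<dots>, x\<^sub>k) = \<Sum>\<^bsub>i<j\<^esub> (-1)\<^bsup>i+j\<^esup> \<omega>([x\<^sub>i, x\<^sub>j], x\<^sub>0, \<dots>, x\<^sub>k)\<close> with \<open>x\<^sub>i\<close> and \<open>x\<^sub>j\<close> omitted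
  from the remaining arguments.
\<close>

definition ce_diff :: "('a \<Rightarrow> 'a \<Rightarrow> 'a) \<Rightarrow> 'a form \<Rightarrow> 'a form" where
  "ce_diff br \<omega> xs =
     (\<Sum>(i, j)\<in>{(i, j). i < j \<and> j < length xs}.
        (-1) ^ (i + j) * \<omega> (br (xs ! i) (xs ! j) # nths xs (- {i, j})))"


section \<open>Inner products and the Hodge star\<close>

definition inner_product :: "('a::real_vector \<Rightarrow> 'a \<Rightarrow> real) \<Rightarrow> bool" where
  "inner_product g \<longleftrightarrow>
     bilinear g \<and> (\<forall>x y. g x y = g y x) \<and> (\<forall>x. x \<noteq> 0 \<longrightarrow> g x x > 0)"

definition orthonormal_frame :: "('a::real_vector \<Rightarrow> 'a \<Rightarrow> real) \<Rightarrow> (nat \<Rightarrow> 'a) \<Rightarrow> bool" where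
  "orthonormal_frame g b \<longleftrightarrow>
     frame b \<and> (\<forall>i\<in>{1..7}. \<forall>j\<in>{1..7}. g (b i) (b j) = (if i = j then 1 else 0))"

text \<open>One of the two volume forms of \<open>g\<close>; choosing one is choosing an orientation.\<close>

definition volume_form :: "('a::real_vector \<Rightarrow> 'a \<Rightarrow> real) \<Rightarrow> 'a form \<Rightarrow> bool" where
  "volume_form g vol \<longleftrightarrow> (\<exists>b. orthonormal_frame g b \<and> vol = coframe b [1, 2, 3, 4, 5, 6, 7])"

text \<open>
  The inner product induced by \<open>g\<close> on \<open>k\<close>-forms, for which the \<open>b\<^bsup>i1\<dots>ik\<^esup>\<close> with \<open>i1 < \<dots> < ik\<close> are
  orthonormal. The sum runs over all multi-indices, hence the division by \<open>k!\<close>; its value does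
  not depend on the orthonormal frame \<open>b\<close>.
\<close>

definition form_inner :: "('a::real_vector \<Rightarrow> 'a \<Rightarrow> real) \<Rightarrow> nat \<Rightarrow> 'a form \<Rightarrow> 'a form \<Rightarrow> real" where
  "form_inner g k \<alpha> \<beta> =
     (THE r. \<forall>b. orthonormal_frame g b \<longrightarrow>
        r = (\<Sum>is | length is = k \<and> set is \<subseteq> {1..7}. \<alpha> (map b is) * \<beta> (map b is)) / fact k)"

definition hodge_star ::
  "('a::real_vector \<Rightarrow> 'a \<Rightarrow> real) \<Rightarrow> 'a form \<Rightarrow> nat \<Rightarrow> 'a form \<Rightarrow> 'a form" where
  "hodge_star g vol k \<omega> =
     (THE \<eta>. is_form (7 - k) \<eta> \<and>
        (\<forall>\<alpha>. is_form k \<alpha> \<longrightarrow> wedge \<alpha> \<eta> = (\<lambda>xs. form_inner g k \<alpha> \<omega> * vol xs)))"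


section \<open>\<open>G\<^sub>2\<close>-structures\<close>

text \<open>
  The inner product and the volume form induced by a 3-form are the (unique) pair with
  \<open>\<iota>\<^sub>X\<phi> \<and> \<iota>\<^sub>Y\<phi> \<and> \<phi> = 6 g(X, Y) vol\<close>. For the model form
  \<open>e\<^sup>1\<^sup>2\<^sup>3 + e\<^sup>1\<^sup>4\<^sup>5 + e\<^sup>1\<^sup>6\<^sup>7 + e\<^sup>2\<^sup>4\<^sup>6 - e\<^sup>2\<^sup>5\<^sup>7 - e\<^sup>3\<^sup>4\<^sup>7 - e\<^sup>3\<^sup>5\<^sup>6\<close> they are the inner product for which
  \<open>e\<close> is orthonormal and the volume form \<open>e\<^sup>1\<^sup>2\<^sup>3\<^sup>4\<^sup>5\<^sup>6\<^sup>7\<close>.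
\<close>

definition g2_induces ::
  "'a::real_vector form \<Rightarrow> ('a \<Rightarrow> 'a \<Rightarrow> real) \<Rightarrow> 'a form \<Rightarrow> bool" where
  "g2_induces \<phi> g vol \<longleftrightarrow>
     inner_product g \<and> volume_form g vol \<and>
     (\<forall>X Y. wedge (wedge (interior X \<phi>) (interior Y \<phi>)) \<phi> = (\<lambda>xs. 6 * g X Y * vol xs))"

definition g2_structure :: "'a::real_vector form \<Rightarrow> bool" where
  "g2_structure \<phi> \<longleftrightarrow> is_form 3 \<phi> \<and> (\<exists>g vol. g2_induces \<phi> g vol)"

definition g2_metric :: "'a::real_vector form \<Rightarrow> 'a \<Rightarrow> 'a \<Rightarrow> real" where
  "g2_metric \<phi> = (THE g. \<exists>vol. g2_induces \<phi> g vol)"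

definition g2_volume :: "'a::real_vector form \<Rightarrow> 'a form" where
  "g2_volume \<phi> = (THE vol. \<exists>g. g2_induces \<phi> g vol)"

definition coclosed :: "('a::real_vector \<Rightarrow> 'a \<Rightarrow> 'a) \<Rightarrow> 'a form \<Rightarrow> bool" where
  "coclosed br \<phi> \<longleftrightarrow>
     g2_structure \<phi> \<and>
     ce_diff br (hodge_star (g2_metric \<phi>) (g2_volume \<phi>) 3 \<phi>) = (\<lambda>xs. 0)"


section \<open>Existence of the Lie algebras\<close>

definition model_bracket ::
  "real \<Rightarrow> real \<Rightarrow> real \<Rightarrow> real \<Rightarrow> real ^ 7 \<Rightarrow> real ^ 7 \<Rightarrow> real ^ 7" where
  "model_bracket a b c d x y =
     (let s = (\<lambda>z :: real ^ 7. a * z $ 1 + c * z $ 2); t = (\<lambda>z :: real ^ 7. b * z $ 1 + d * z $ 2) in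
      (\<chi> k. if k = 4 then s y * x $ 5 - s x * y $ 5
            else if k = 5 then s x * y $ 4 - s y * x $ 4
            else if k = 6 then t y * x $ 7 - t x * y $ 7
            else if k = 7 then t x * y $ 6 - t y * x $ 6
            else 0))"

lemma lie_algebra_model_bracket: "lie_algebra (model_bracket a b c d)"
  unfolding lie_algebra_def
proof (intro conjI allI)
  show "bilinear (model_bracket a b c d)"
    unfolding bilinear_def
    by (auto intro!: linearI simp: model_bracket_def vec_eq_iff algebra_simps)
  show "model_bracket a b c d x x = 0" for x
    by (simp add: model_bracket_def vec_eq_iff)
  show "model_bracket a b c d x (model_bracket a b c d y z) +
        model_bracket a b c d y (model_bracket a b c d z x) +
        model_bracket a b c d z (model_bracket a b c d x y) = 0" for x y z
    by (simp add: model_bracket_def vec_eq_iff algebra_simps)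
qed

lemma frame_axis: "frame (\<lambda>i. axis (of_nat i) 1 :: real ^ 7)"
proof -
  let ?e = "\<lambda>i. axis (of_nat i) 1 :: real ^ 7"
  have inj: "inj_on (of_nat :: nat \<Rightarrow> 7) {1..7}"
    by (simp add: inj_on_def atLeastAtMost_upt upt_rec numeral_eq_Suc)
  have univ: "(of_nat :: nat \<Rightarrow> 7) ` {1..7} = UNIV"
    by (rule card_subset_eq) (use card_image[OF inj] in simp_all)
  have "?e ` {1..7} = (\<lambda>k. axis k 1) ` ((of_nat :: nat \<Rightarrow> 7) ` {1..7})"
    by (simp only: image_image)
  also have "\<dots> = Basis"
    unfolding univ by (auto simp: Basis_vec_def)
  finally have img: "?e ` {1..7} = Basis" .
  have "inj_on ?e {1..7}"
    using inj by (auto simp: inj_on_def axis_eq_axis)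
  then show ?thesis
    unfolding frame_def img by (simp add: independent_Basis)
qed

lemma lie_algebra_g_exists:
  "lie_algebra_g a b c d (model_bracket a b c d) (\<lambda>i. axis (of_nat i) 1)"
proof -
  have range7: "{1..7} = {1, 2, 3, 4, 5, 6, 7 :: nat}" "{4..7} = {4, 5, 6, 7 :: nat}"
    by auto
  show ?thesis
    unfolding lie_algebra_g_def range7
    by (intro conjI lie_algebra_model_bracket frame_axis)
      (simp_all add: model_bracket_def vec_eq_iff axis_def)
qed

end

theory Submission
  imports Defs "HOL-Combinatorics.Multiset_Permutations"
begin

text \<open>
  Contraction by a vector is an antiderivation for the wedge product and satisfies Cartan's formula
  for the differential, so wedge products and differentials are evaluated recursively, on lists of
  basis vectors; a form is determined by its values on increasing lists.

  If \<open>(g, vol)\<close> and \<open>(g', vol')\<close> are both induced by \<open>\<phi>\<close> and \<open>vol = s vol'\<close>, then \<open>g' = s g\<close>; comparing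
  the volumes of orthonormal frames gives \<open>s\<^sup>9 = 1\<close>, hence \<open>s = 1\<close>. So \<open>\<phi>\<close> induces the metric for which
  \<open>e\<close> is orthonormal, and its Hodge dual is
  \<open>\<psi> = e\<^sup>4\<^sup>5\<^sup>6\<^sup>7 + e\<^sup>2\<^sup>3\<^sup>6\<^sup>7 + e\<^sup>2\<^sup>3\<^sup>4\<^sup>5 + e\<^sup>1\<^sup>3\<^sup>5\<^sup>7 - e\<^sup>1\<^sup>3\<^sup>4\<^sup>6 - e\<^sup>1\<^sup>2\<^sup>5\<^sup>6 - e\<^sup>1\<^sup>2\<^sup>4\<^sup>7\<close>.
  With \<open>\<alpha> = a e\<^sup>1 + c e\<^sup>2\<close> and \<open>\<beta> = b e\<^sup>1 + d e\<^sup>2\<close>, the bracket rotates the planes \<open>e\<^sup>4, e\<^sup>5\<close> and \<open>e\<^sup>6, e\<^sup>7\<close> by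
  \<open>\<alpha>\<close> and \<open>\<beta>\<close>. Thus \<open>e\<^sup>4\<^sup>5\<close> and \<open>e\<^sup>6\<^sup>7\<close> are closed, while \<open>e\<^sup>4\<^sup>6 - e\<^sup>5\<^sup>7\<close> is rotated by \<open>\<alpha> + \<beta>\<close>, so that
  \<open>d\<psi>\<close> is, up to sign, \<open>(c + d) e\<^sup>1\<^sup>2\<^sup>3 \<and> (e\<^sup>4\<^sup>7 + e\<^sup>5\<^sup>6)\<close>.
\<close>


section \<open>Alternating multilinear functions on lists\<close>

text \<open>No degree is fixed: the conditions range over lists of every length, so contraction and
  \<open>grade_inv\<close> preserve the notion without any bookkeeping of degrees.\<close>

definition alternating :: "'a::real_vector form \<Rightarrow> bool" where
  "alternating \<omega> \<longleftrightarrow>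
     (\<forall>xs ys. linear (\<lambda>v. \<omega> (xs @ v # ys))) \<and> (\<forall>xs v ys. \<omega> (xs @ v # v # ys) = 0)"

text \<open>The grading involution of the exterior algebra; it carries the sign in the
  antiderivation rule.\<close>

definition grade_inv :: "'a form \<Rightarrow> 'a form" where
  "grade_inv \<omega> xs = (-1) ^ length xs * \<omega> xs"

lemma alternating_linear: "alternating \<omega> \<Longrightarrow> linear (\<lambda>v. \<omega> (xs @ v # ys))"
  by (simp add: alternating_def)

lemma alternating_linear_hd: "alternating \<omega> \<Longrightarrow> linear (\<lambda>v. \<omega> (v # ys))"
  using alternating_linear[of \<omega> "[]"] by simp

lemma alternating_repeat: "alternating \<omega> \<Longrightarrow> \<omega> (xs @ v # v # ys) = 0"
  by (simp add: alternating_def)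

text \<open>Polarization: \<omega> vanishes when u + v fills two adjacent slots, and expanding
  leaves only the two mixed terms.\<close>

lemma alternating_swap:
  assumes "alternating \<omega>"
  shows "\<omega> (xs @ u # v # ys) = - \<omega> (xs @ v # u # ys)"
proof -
  have l1: "linear (\<lambda>w. \<omega> (xs @ w # z # ys))" for z
    using alternating_linear[OF assms, of xs "z # ys"] by simp
  have l2: "linear (\<lambda>w. \<omega> (xs @ z # w # ys))" for z
    using alternating_linear[OF assms, of "xs @ [z]" ys] by simp
  have "0 = \<omega> (xs @ (u + v) # (u + v) # ys)"
    by (simp add: alternating_repeat[OF assms])
  also have "\<dots> = \<omega> (xs @ u # v # ys) + \<omega> (xs @ v # u # ys)"
    unfolding linear_add[OF l1] linear_add[OF l2] by (simp add: alternating_repeat[OF assms])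
  finally show ?thesis by linarith
qed

lemma alternating_swap_hd:
  assumes "alternating \<omega>"
  shows "\<omega> (u # v # ys) = - \<omega> (v # u # ys)"
  by (rule alternating_swap[OF assms, of "[]", unfolded append_Nil])

lemma alternating_move:
  assumes "alternating \<omega>"
  shows "\<omega> (xs @ v # ys @ zs) = (-1) ^ length ys * \<omega> (xs @ ys @ v # zs)"
proof (induction ys arbitrary: xs)
  case (Cons y ys)
  show ?case
    using alternating_swap[OF assms, of xs v y "ys @ zs"] Cons[of "xs @ [y]"] by simp
qed simp

lemma alternating_not_distinct:
  assumes "alternating \<omega>" "\<not> distinct xs"
  shows "\<omega> xs = 0"
proof -
  obtain as v bs cs where xs: "xs = as @ [v] @ bs @ [v] @ cs"
    using not_distinct_decomp[OF assms(2)] by blast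
  have "\<omega> xs = (-1) ^ length bs * \<omega> (as @ bs @ v # v # cs)"
    using alternating_move[OF assms(1), of as v bs "v # cs"] by (simp add: xs)
  then show ?thesis
    using alternating_repeat[OF assms(1), of "as @ bs" v cs] by simp
qed

lemma is_form_iff:
  "is_form k \<omega> \<longleftrightarrow> alternating \<omega> \<and> (\<forall>xs. length xs \<noteq> k \<longrightarrow> \<omega> xs = 0)"
proof (intro iffI conjI)
  assume f: "is_form k \<omega>"
  show "\<forall>xs. length xs \<noteq> k \<longrightarrow> \<omega> xs = 0"
    using f by (simp add: is_form_def)
  have "linear (\<lambda>v. \<omega> (xs @ v # ys))" for xs ys
  proof (cases "length xs + 1 + length ys = k")
    case False
    then have "(\<lambda>v. \<omega> (xs @ v # ys)) = (\<lambda>v. 0)"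
      using f by (auto simp: is_form_def)
    then show ?thesis by (simp only: linear_zero)
  qed (use f in \<open>simp add: is_form_def\<close>)
  moreover have "\<omega> (xs @ v # v # ys) = 0" for xs v ys
    using f by (simp add: is_form_def)
  ultimately show "alternating \<omega>" by (simp add: alternating_def)
qed (simp add: is_form_def alternating_linear alternating_not_distinct)

lemma is_form_alternating: "is_form k \<omega> \<Longrightarrow> alternating \<omega>"
  by (simp add: is_form_iff)

lemma alternating_interior: "alternating \<omega> \<Longrightarrow> alternating (interior x \<omega>)"
  using alternating_linear[of \<omega> "x # xs" for xs] alternating_repeat[of \<omega> "x # xs" for xs]
  by (simp add: alternating_def interior_def)

lemma alternating_grade_inv:
  assumes "alternating \<omega>"
  shows "alternating (grade_inv \<omega>)"
  unfolding alternating_def grade_inv_def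
proof (intro conjI allI)
  show "linear (\<lambda>v. (-1) ^ length (xs @ v # ys) * \<omega> (xs @ v # ys))" for xs ys
    using linear_compose_scale_right[OF alternating_linear[OF assms], of "(-1) ^ (length xs + Suc (length ys))" xs ys]
    by simp
qed (simp add: alternating_repeat[OF assms])

lemma is_form_interior: "is_form (Suc k) \<omega> \<Longrightarrow> is_form k (interior x \<omega>)"
  by (simp add: is_form_iff alternating_interior) (simp add: interior_def)

lemma alternating_lincomb:
  assumes "alternating \<alpha>" "alternating \<beta>"
  shows "alternating (\<lambda>xs. s * \<alpha> xs + t * \<beta> xs)"
  unfolding alternating_def
  by (intro conjI allI linear_compose_add linear_compose_scale_right[where 'a = 'a and 'b = real, simplified]
      alternating_linear assms) (simp add: alternating_repeat assms)

lemma is_form_lincomb: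
  "is_form k \<alpha> \<Longrightarrow> is_form k \<beta> \<Longrightarrow> is_form k (\<lambda>xs. s * \<alpha> xs + t * \<beta> xs)"
  by (simp add: is_form_iff alternating_lincomb)

lemma is_form_add: "is_form k \<alpha> \<Longrightarrow> is_form k \<beta> \<Longrightarrow> is_form k (\<lambda>xs. \<alpha> xs + \<beta> xs)"
  using is_form_lincomb[of k \<alpha> \<beta> 1 1] by simp

lemma is_form_diff: "is_form k \<alpha> \<Longrightarrow> is_form k \<beta> \<Longrightarrow> is_form k (\<lambda>xs. \<alpha> xs - \<beta> xs)"
  using is_form_lincomb[of k \<alpha> \<beta> 1 "-1"] by simp

lemma is_form_scale: "is_form k \<alpha> \<Longrightarrow> is_form k (\<lambda>xs. s * \<alpha> xs)"
  using is_form_lincomb[of k \<alpha> \<alpha> s 0] by simp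


section \<open>Wedge product\<close>

lemma wedge_Nil [simp]: "wedge \<alpha> \<beta> [] = \<alpha> [] * \<beta> []"
  by (simp add: wedge_def shuffle_sign_def)

text \<open>Position 0 in the first factor precedes everything, so it creates no inversion.\<close>

lemma shuffle_sign_insert_0:
  assumes "I \<subseteq> {..<n}"
  shows "shuffle_sign (Suc n) (insert 0 (Suc ` I)) = shuffle_sign n I"
proof -
  have "{(i, j). i \<in> insert 0 (Suc ` I) \<and> j \<in> {..<Suc n} - insert 0 (Suc ` I) \<and> j < i} =
      map_prod Suc Suc ` {(i, j). i \<in> I \<and> j \<in> {..<n} - I \<and> j < i}"
    by (auto simp: image_iff less_Suc_eq_0_disj)
  moreover have "inj_on (map_prod Suc Suc) A" for A
    by (auto simp: inj_on_def)
  ultimately show ?thesis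
    by (simp add: shuffle_sign_def card_image)
qed

text \<open>Position 0 goes to the second factor, and every element of \<open>I\<close> has to cross
  it, which gives \<open>card I\<close> new inversions.\<close>

lemma shuffle_sign_Suc_image:
  assumes "I \<subseteq> {..<n}"
  shows "shuffle_sign (Suc n) (Suc ` I) = (-1) ^ card I * shuffle_sign n I"
proof -
  let ?S = "{(i, j). i \<in> I \<and> j \<in> {..<n} - I \<and> j < i}"
  have fin: "finite I" using assms finite_subset by blast
  have finS: "finite ?S"
    by (rule finite_subset[of _ "I \<times> {..<n}"]) (use fin in auto)
  have eq: "{(i, j). i \<in> Suc ` I \<and> j \<in> {..<Suc n} - Suc ` I \<and> j < i} =
      (\<lambda>i. (Suc i, 0)) ` I \<union> map_prod Suc Suc ` ?S"
    by (auto simp: image_iff less_Suc_eq_0_disj)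
  have inj: "inj_on (map_prod Suc Suc) A" "inj_on (\<lambda>i. (Suc i, 0::nat)) I" for A
    by (auto simp: inj_on_def)
  have "card ((\<lambda>i. (Suc i, 0)) ` I \<union> map_prod Suc Suc ` ?S) = card I + card ?S"
    by (subst card_Un_disjoint) (use fin finS inj in \<open>auto simp: card_image\<close>)
  then show ?thesis
    by (simp only: shuffle_sign_def eq power_add)
qed

text \<open>The contraction by \<open>x\<close> is an antiderivation; this recursion replaces the shuffle sum.\<close>

lemma wedge_Cons:
  "wedge \<alpha> \<beta> (x # xs) = wedge (interior x \<alpha>) \<beta> xs + wedge (grade_inv \<alpha>) (interior x \<beta>) xs"
proof -
  let ?n = "length xs"
  let ?t = "\<lambda>I. shuffle_sign (Suc ?n) I * \<alpha> (nths (x # xs) I) * \<beta> (nths (x # xs) (- I))"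
  have "Pow {..<Suc ?n} = (`) Suc ` Pow {..<?n} \<union> (\<lambda>I. insert 0 (Suc ` I)) ` Pow {..<?n}"
    unfolding lessThan_Suc_eq_insert_0 Pow_insert image_Pow_surj[OF refl] image_image[symmetric] by simp
  then have "wedge \<alpha> \<beta> (x # xs) =
      sum ?t ((`) Suc ` Pow {..<?n} \<union> (\<lambda>I. insert 0 (Suc ` I)) ` Pow {..<?n})"
    by (simp add: wedge_def)
  also have "\<dots> = sum ?t ((`) Suc ` Pow {..<?n}) + sum ?t ((\<lambda>I. insert 0 (Suc ` I)) ` Pow {..<?n})"
    by (rule sum.union_disjoint) auto
  also have "sum ?t ((`) Suc ` Pow {..<?n}) = wedge (grade_inv \<alpha>) (interior x \<beta>) xs"
    unfolding wedge_def
  proof (subst sum.reindex, force simp: inj_on_def, rule sum.cong[OF refl])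
    fix I assume "I \<in> Pow {..<?n}"
    then have I: "I \<subseteq> {..<?n}" by simp
    have "{i. i < ?n \<and> i \<in> I} = I" using I by auto
    then have "length (nths xs I) = card I" by (simp add: length_nths)
    then show "(?t \<circ> (`) Suc) I = shuffle_sign ?n I * grade_inv \<alpha> (nths xs I) * interior x \<beta> (nths xs (- I))"
      by (auto simp: shuffle_sign_Suc_image[OF I] nths_Cons grade_inv_def interior_def image_iff Compl_eq)
  qed
  also have "sum ?t ((\<lambda>I. insert 0 (Suc ` I)) ` Pow {..<?n}) = wedge (interior x \<alpha>) \<beta> xs"
    unfolding wedge_def
  proof (subst sum.reindex, force simp: inj_on_def, rule sum.cong[OF refl])
    fix I assume "I \<in> Pow {..<?n}"
    then have I: "I \<subseteq> {..<?n}" by simp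
    show "(?t \<circ> (\<lambda>I. insert 0 (Suc ` I))) I = shuffle_sign ?n I * interior x \<alpha> (nths xs I) * \<beta> (nths xs (- I))"
      by (auto simp: shuffle_sign_insert_0[OF I] nths_Cons interior_def image_iff Compl_eq)
  qed
  finally show ?thesis by simp
qed

lemma linear_wedge_left:
  assumes "\<And>zs. linear (\<lambda>v. F v zs)"
  shows "linear (\<lambda>v. wedge (F v) \<beta> zs)"
  unfolding wedge_def
  by (rule linear_compose_sum, rule ballI)
    (simp add: linear_iff algebra_simps linear_add[OF assms] linear_scale[OF assms])

lemma linear_wedge_right:
  assumes "\<And>zs. linear (\<lambda>v. F v zs)"
  shows "linear (\<lambda>v. wedge \<alpha> (F v) zs)"
  unfolding wedge_def
  by (rule linear_compose_sum, rule ballI)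
    (simp add: linear_iff algebra_simps linear_add[OF assms] linear_scale[OF assms])

lemma grade_inv_interior: "grade_inv (interior x \<alpha>) zs = - interior x (grade_inv \<alpha>) zs"
  by (simp add: grade_inv_def interior_def)

lemma wedge_minus_left: "wedge (\<lambda>zs. - \<alpha> zs) \<beta> xs = - wedge \<alpha> \<beta> xs"
  by (simp add: wedge_def sum_negf)

lemma wedge_zero_left: "wedge (\<lambda>zs. 0) \<beta> xs = 0"
  by (simp add: wedge_def)

lemma wedge_zero_right: "wedge \<alpha> (\<lambda>zs. 0) xs = 0"
  by (simp add: wedge_def)

text \<open>Since contraction and \<open>grade_inv\<close> preserve alternation,
  \<open>wedge_Cons\<close> strips the leading arguments, and only the front slots need an
  argument.\<close>

lemma alternating_wedge:
  assumes "alternating \<alpha>" "alternating \<beta>"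
  shows "alternating (wedge \<alpha> \<beta>)"
  unfolding alternating_def
proof (intro conjI allI)
  fix xs ys
  show "linear (\<lambda>v. wedge \<alpha> \<beta> (xs @ v # ys))"
    using assms
  proof (induction xs arbitrary: \<alpha> \<beta>)
    case Nil
    show ?case
      by (auto simp: wedge_Cons interior_def intro!: linear_compose_add linear_wedge_left
          linear_wedge_right alternating_linear_hd Nil)
  next
    case (Cons x xs)
    show ?case
      by (simp add: wedge_Cons)
        (intro linear_compose_add Cons.IH alternating_interior alternating_grade_inv Cons.prems)
  qed
next
  fix xs v ys
  show "wedge \<alpha> \<beta> (xs @ v # v # ys) = 0"
    using assms
  proof (induction xs arbitrary: \<alpha> \<beta>)
    case Nil
    have "interior v (interior v \<omega>) = (\<lambda>zs. 0)" if "alternating \<omega>" for \<omega> :: "'a form"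
      using alternating_repeat[OF that, of "[]"] by (auto simp: interior_def)
    \<comment> \<open>The two mixed terms of the double contraction cancel because
      \<open>grade_inv\<close> anticommutes with contraction.\<close>
    moreover have "wedge (interior v (grade_inv \<alpha>)) (interior v \<beta>) ys =
        - wedge (grade_inv (interior v \<alpha>)) (interior v \<beta>) ys"
      by (simp add: grade_inv_interior wedge_minus_left[symmetric])
    ultimately show ?case
      using Nil by (simp add: wedge_Cons wedge_zero_left wedge_zero_right)
  next
    case (Cons x xs)
    then show ?case
      by (simp add: wedge_Cons alternating_interior alternating_grade_inv)
  qed
qed

text \<open>For the degree: a set of positions and its complement split the arguments, so on a list
  of the wrong length some factor always receives the wrong number of them.\<close>

lemma is_form_wedge:
  assumes "is_form j \<alpha>" "is_form k \<beta>"
  shows "is_form (j + k) (wedge \<alpha> \<beta>)"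
  unfolding is_form_iff
proof (intro conjI allI impI)
  show "alternating (wedge \<alpha> \<beta>)"
    using assms by (simp add: alternating_wedge is_form_alternating)
next
  fix xs :: "'a list"
  assume len: "length xs \<noteq> j + k"
  have "\<alpha> (nths xs I) = 0 \<or> \<beta> (nths xs (- I)) = 0" for I
  proof -
    have "card {i. i < length xs \<and> i \<in> I} + card {i. i < length xs \<and> i \<in> - I} = card {..<length xs}"
      by (rule trans[OF card_Un_disjoint[symmetric] arg_cong[of _ _ card]]) auto
    then have "length (nths xs I) + length (nths xs (- I)) = length xs"
      by (simp only: length_nths card_lessThan)
    then have "length (nths xs I) \<noteq> j \<or> length (nths xs (- I)) \<noteq> k"
      using len by linarith
    then show ?thesis using assms unfolding is_form_iff by blast
  qed
  then show "wedge \<alpha> \<beta> xs = 0"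
    by (auto simp: wedge_def intro!: sum.neutral)
qed


section \<open>Forms in terms of a basis\<close>

lemma frame_coords:
  assumes "frame e"
  shows frame_expand: "x = (\<Sum>i = 1..7. dual_form e i [x] *\<^sub>R e i)"
    and dual_form_basis: "i \<in> {1..7} \<Longrightarrow> j \<in> {1..7} \<Longrightarrow> dual_form e i [e j] = (if i = j then 1 else 0)"
    and linear_dual_form: "linear (\<lambda>x. dual_form e i [x])"
proof -
  have inj: "inj_on e {1..7}" and ind: "independent (e ` {1..7})" and sp: "span (e ` {1..7}) = UNIV"
    using assms by (auto simp: frame_def)
  have "(\<Sum>v\<in>e ` {1..7}. representation (e ` {1..7}) x v *\<^sub>R v) = x"
    by (rule real_vector.sum_representation_eq[OF ind]) (auto simp: sp simp del: One_nat_def)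
  then show "x = (\<Sum>i = 1..7. dual_form e i [x] *\<^sub>R e i)"
    by (simp add: sum.reindex[OF inj] dual_form_def del: One_nat_def)
  show "dual_form e i [e j] = (if i = j then 1 else 0)" if "i \<in> {1..7}" "j \<in> {1..7}"
    using that inj
    by (auto simp: dual_form_def real_vector.representation_basis[OF ind] inj_on_def simp del: One_nat_def)
  show "linear (\<lambda>x. dual_form e i [x])"
    by (auto intro!: linearI
        simp: dual_form_def sp real_vector.representation_add[OF ind] real_vector.representation_scale[OF ind]
        simp del: One_nat_def)
qed

lemma dual_form_length [simp]:
  "dual_form e i [] = 0" "dual_form e i (x # y # zs) = 0"
  by (simp_all add: dual_form_def)

lemma is_form_dual_form:
  assumes "frame e"
  shows "is_form 1 (dual_form e i)"
  unfolding is_form_def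
proof (intro conjI allI impI)
  fix xs ys :: "'a list"
  show "dual_form e i xs = 0" if "length xs \<noteq> 1"
    using that by (auto simp: dual_form_def split: list.split)
  show "linear (\<lambda>v. dual_form e i (xs @ v # ys))" if "length xs + 1 + length ys = 1"
    using that linear_dual_form[OF assms] by simp
  show "dual_form e i xs = 0" if "\<not> distinct xs"
    using that by (auto simp: dual_form_def split: list.split)
qed

lemma unit_form_simps [simp]: "unit_form [] = 1" "unit_form (x # xs) = 0"
  by (simp_all add: unit_form_def)

lemma is_form_unit_form: "is_form 0 (unit_form :: 'a::real_vector form)"
  by (auto simp: is_form_def unit_form_def)

lemma coframe_Nil: "coframe e [] = unit_form"
  by (simp add: coframe_def)

lemma coframe_Cons: "coframe e (i # is) = wedge (dual_form e i) (coframe e is)"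
  by (simp add: coframe_def)

lemma is_form_coframe:
  assumes "frame e"
  shows "is_form (length is) (coframe e is)"
  by (induction "is") (use is_form_wedge[OF is_form_dual_form[OF assms]] in
      \<open>simp_all add: coframe_Nil coframe_Cons is_form_unit_form\<close>)

lemma wedge_scale_left: "wedge (\<lambda>zs. s * \<alpha> zs) \<beta> xs = s * wedge \<alpha> \<beta> xs"
  by (simp add: wedge_def sum_distrib_left algebra_simps)

lemma wedge_add_right: "wedge \<alpha> (\<lambda>zs. \<beta> zs + \<gamma> zs) xs = wedge \<alpha> \<beta> xs + wedge \<alpha> \<gamma> xs"
  by (simp add: wedge_def sum.distrib algebra_simps)

lemma wedge_diff_right: "wedge \<alpha> (\<lambda>zs. \<beta> zs - \<gamma> zs) xs = wedge \<alpha> \<beta> xs - wedge \<alpha> \<gamma> xs"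
  by (simp add: wedge_def sum_subtractf algebra_simps)

lemma wedge_unit_left:
  fixes \<beta> :: "'a form"
  shows "wedge unit_form \<beta> xs = \<beta> xs"
proof (induction xs arbitrary: \<beta>)
  case (Cons x xs)
  have "interior x unit_form = (\<lambda>zs. 0)" "grade_inv unit_form = (unit_form :: 'a form)"
    by (auto simp: interior_def grade_inv_def unit_form_def)
  then show ?case by (simp add: wedge_Cons Cons wedge_zero_left) (simp add: interior_def)
qed simp

lemma wedge_unit_right: "wedge \<alpha> unit_form xs = \<alpha> xs"
proof (induction xs arbitrary: \<alpha>)
  case (Cons x xs)
  have "interior x unit_form = (\<lambda>zs. 0)"
    by (auto simp: interior_def)
  then show ?case by (simp add: wedge_Cons Cons wedge_zero_right) (simp add: interior_def)
qed simp

text \<open>The antiderivation rule for a 1-form, whose contraction is a scalar. Iterated, it is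
  Laplace expansion of a determinant.\<close>

lemma wedge_dual_form_Cons:
  "wedge (dual_form e i) \<beta> (x # xs) = dual_form e i [x] * \<beta> xs - wedge (dual_form e i) (interior x \<beta>) xs"
proof -
  have "interior x (dual_form e i) = (\<lambda>zs. dual_form e i [x] * unit_form zs)"
    by (auto simp: interior_def unit_form_def dual_form_def split: list.split)
  moreover have "grade_inv (dual_form e i) = (\<lambda>zs. - dual_form e i zs)"
    by (auto simp: grade_inv_def dual_form_def split: list.split)
  ultimately show ?thesis
    by (simp add: wedge_Cons wedge_scale_left wedge_unit_left wedge_minus_left)
qed

section \<open>Coframes and their wedge products on lists of basis vectors\<close>

lemma interior_apply: "interior x \<omega> zs = \<omega> (x # zs)"
  by (simp add: interior_def)

lemma interior_coframe_notin:
  assumes "frame e" "j \<in> {1..7}" "set is \<subseteq> {1..7}" "j \<notin> set is"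
  shows "interior (e j) (coframe e is) = (\<lambda>zs. 0)"
  using assms(3,4)
proof (induction "is")
  case Nil
  then show ?case by (auto simp: coframe_Nil interior_def)
next
  case (Cons i "is")
  then have "interior (e j) (coframe e is) = (\<lambda>zs. 0)" "dual_form e i [e j] = 0"
    using assms(2) dual_form_basis[OF assms(1), of i j] by auto
  then show ?case
    by (auto simp: coframe_Cons interior_apply[of "e j" "wedge _ _"] wedge_dual_form_Cons wedge_zero_right)
qed

lemma interior_coframe_hd:
  assumes "frame e" "i \<in> {1..7}" "set is \<subseteq> {1..7}" "i \<notin> set is"
  shows "interior (e i) (coframe e (i # is)) = coframe e is"
  using interior_coframe_notin[OF assms] dual_form_basis[OF assms(1), of i i] assms(2)
  by (auto simp: coframe_Cons interior_apply[of "e i" "wedge _ _"] wedge_dual_form_Cons wedge_zero_right)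

text \<open>In every term of the expansion the factor \<open>e\<^sup>k\<close> meets a basis vector
  other than \<open>e\<^sub>k\<close>.\<close>

lemma coframe_vanish:
  assumes "frame e" "k \<in> {1..7}" "k \<in> set is" "k \<notin> set ls" "set ls \<subseteq> {1..7}"
  shows "coframe e is (map e ls) = 0"
  using assms(3-)
proof (induction "is" arbitrary: ls)
  case (Cons i "is")
  \<comment> \<open>The second factor is kept arbitrary because the induction on \<open>ls\<close>
    contracts it. The vanishing assumption survives contraction by \<open>e l\<close>, as
    \<open>l\<close> differs from \<open>k\<close>.\<close>
  have *: "wedge (dual_form e i) \<beta> (map e ls) = 0"
    if "k \<notin> set ls" "set ls \<subseteq> {1..7}"
       "i = k \<or> (\<forall>ls. k \<notin> set ls \<longrightarrow> set ls \<subseteq> {1..7} \<longrightarrow> \<beta> (map e ls) = 0)"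
    for \<beta> ls
    using that
  proof (induction ls arbitrary: \<beta>)
    case (Cons l ls)
    have "i = k \<Longrightarrow> dual_form e i [e l] = 0"
      using dual_form_basis[OF assms(1,2), of l] Cons.prems by auto
    moreover have "wedge (dual_form e i) (interior (e l) \<beta>) (map e ls) = 0"
      by (rule Cons.IH) (use Cons.prems in \<open>auto simp: interior_apply list.map(2)[symmetric] simp del: list.map\<close>)
    ultimately show ?case
      using Cons.prems by (auto simp: wedge_dual_form_Cons)
  qed simp
  show ?case
    unfolding coframe_Cons by (rule *) (use Cons in auto)
qed simp

lemma set_nths_subset: "set (nths xs I) \<subseteq> set xs"
  by (auto dest: in_set_nthsD)

lemma wedge_coframe_notin_left:
  assumes "frame e" "k \<in> set is" "k \<in> {1..7}" "k \<notin> set js" "set js \<subseteq> {1..7}"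
  shows "wedge (coframe e is) \<beta> (map e js) = 0"
  unfolding wedge_def
  by (rule sum.neutral, rule ballI)
    (use assms set_nths_subset[of js] in \<open>fastforce simp: nths_map intro!: coframe_vanish[where k = k]\<close>)

lemma wedge_coframe_notin_right:
  assumes "frame e" "k \<in> set is" "k \<in> {1..7}" "k \<notin> set js" "set js \<subseteq> {1..7}"
  shows "wedge \<alpha> (coframe e is) (map e js) = 0"
  unfolding wedge_def
  by (rule sum.neutral, rule ballI)
    (use assms set_nths_subset[of js] in \<open>fastforce simp: nths_map intro!: coframe_vanish[where k = k]\<close>)

lemma grade_inv_is_form: "is_form k \<omega> \<Longrightarrow> grade_inv \<omega> = (\<lambda>zs. (-1) ^ k * \<omega> zs)"
  by (rule ext, metis grade_inv_def is_form_def mult_zero_right)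

lemma wedge_coframe_skip:
  assumes "frame e" "j \<in> {1..7}" "set is \<subseteq> {1..7}" "j \<notin> set is"
  shows "wedge (coframe e is) \<beta> (e j # xs) = (-1) ^ length is * wedge (coframe e is) (interior (e j) \<beta>) xs"
    and "wedge \<alpha> (coframe e is) (e j # xs) = wedge (interior (e j) \<alpha>) (coframe e is) xs"
  by (simp_all add: wedge_Cons interior_coframe_notin[OF assms] wedge_zero_left wedge_zero_right
      grade_inv_is_form[OF is_form_coframe[OF assms(1)]] wedge_scale_left)

text \<open>The basis vector must go to the coframe: given to the other factor, it would leave
  \<open>e\<^sup>j\<close> in the coframe with no \<open>e\<^sub>j\<close> among the remaining
  arguments.\<close>

lemma wedge_coframe_take:
  assumes "frame e" "j \<in> {1..7}" "set is \<subseteq> {1..7}" "j \<notin> set is" "j \<notin> set js" "set js \<subseteq> {1..7}"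
  shows "wedge (coframe e (j # is)) \<beta> (map e (j # js)) = wedge (coframe e is) \<beta> (map e js)"
    and "wedge \<alpha> (coframe e (j # is)) (map e (j # js)) = wedge (grade_inv \<alpha>) (coframe e is) (map e js)"
proof -
  have j: "j \<in> set (j # is)" by simp
  show "wedge (coframe e (j # is)) \<beta> (map e (j # js)) = wedge (coframe e is) \<beta> (map e js)"
    using wedge_coframe_notin_left[OF assms(1) j assms(2,5,6)]
    by (simp add: wedge_Cons interior_coframe_hd[OF assms(1-4)] wedge_scale_left wedge_minus_left
        grade_inv_is_form[OF is_form_coframe[OF assms(1)]])
  show "wedge \<alpha> (coframe e (j # is)) (map e (j # js)) = wedge (grade_inv \<alpha>) (coframe e is) (map e js)"
    using wedge_coframe_notin_right[OF assms(1) j assms(2,5,6)]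
    by (simp add: wedge_Cons interior_coframe_hd[OF assms(1-4)])
qed

text \<open>Along \<open>js\<close>, the coframe takes the indices satisfying \<open>P\<close> and
  passes the others on, at the cost of a sign independent of \<eta>. Wedging with coframes thus
  reads off each coefficient of \<eta>.\<close>

lemma wedge_coframe_complement:
  assumes "frame e" "distinct js" "set js \<subseteq> {1..7}"
  shows "\<exists>s. s \<noteq> 0 \<and> (\<forall>\<eta>. wedge (coframe e (filter P js)) \<eta> (map e js) = s * \<eta> (map e (filter (\<lambda>j. \<not> P j) js)))"
  using assms(2,3)
proof (induction js)
  case Nil
  then show ?case by (auto simp: coframe_Nil wedge_unit_left intro!: exI[of _ 1])
next
  case (Cons j js)
  then obtain s where s: "s \<noteq> 0"
    "\<And>\<eta>. wedge (coframe e (filter P js)) \<eta> (map e js) = s * \<eta> (map e (filter (\<lambda>j. \<not> P j) js))"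
    by auto
  have f: "j \<in> {1..7}" "set (filter P js) \<subseteq> {1..7}" "j \<notin> set (filter P js)" "j \<notin> set js" "set js \<subseteq> {1..7}"
    using Cons.prems by auto
  show ?case
  proof (cases "P j")
    case True
    then show ?thesis
      using s wedge_coframe_take(1)[OF assms(1) f] by (intro exI[of _ s]) (simp del: list.map add: list.map(1))
  next
    case False
    then show ?thesis
      using s wedge_coframe_skip(1)[OF assms(1) f(1-3)]
      by (intro exI[of _ "(-1) ^ length (filter P js) * s"]) (simp add: interior_apply)
  qed
qed

section \<open>Sorting arguments, and testing forms on increasing lists\<close>

lemma alternating_insort:
  "\<exists>s\<in>{1, -1}. \<forall>\<omega> zs. alternating \<omega> \<longrightarrow> \<omega> (zs @ b i # map b js) = s * \<omega> (zs @ map b (insort i js))"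
proof (induction js)
  case (Cons j js)
  then obtain s where s: "s \<in> {1, -1}"
    "\<And>\<omega> zs. alternating \<omega> \<Longrightarrow> \<omega> (zs @ b i # map b js) = s * \<omega> (zs @ map b (insort i js))"
    by blast
  show ?case
  proof (cases "i \<le> j")
    case False
    have "\<omega> (zs @ b i # b j # map b js) = - s * \<omega> (zs @ b j # map b (insort i js))"
      if "alternating \<omega>" for \<omega> zs
      using s(2)[OF that, of "zs @ [b j]"] alternating_swap[OF that, of zs "b i" "b j" "map b js"] by simp
    with False s(1) show ?thesis
      by (intro bexI[of _ "- s"]) auto
  qed auto
qed auto

text \<open>The sign belongs to the permutation and is chosen before \<omega>, so it cancels in
  products of two forms. The prefix \<open>zs\<close> holds the arguments already passed in the
  induction.\<close>

lemma alternating_sort: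
  "\<exists>s\<in>{1, -1}. \<forall>\<omega> zs. alternating \<omega> \<longrightarrow> \<omega> (zs @ map b is) = s * \<omega> (zs @ map b (sort is))"
proof (induction "is")
  case (Cons i "is")
  then obtain s where s: "s \<in> {1, -1}"
    "\<And>\<omega> zs. alternating \<omega> \<Longrightarrow> \<omega> (zs @ map b is) = s * \<omega> (zs @ map b (sort is))"
    by blast
  obtain t where t: "t \<in> {1, -1}"
    "\<And>\<omega> zs. alternating \<omega> \<Longrightarrow> \<omega> (zs @ b i # map b (sort is)) = t * \<omega> (zs @ map b (insort i (sort is)))"
    using alternating_insort[of b i "sort is"] by blast
  have "\<omega> (zs @ b i # map b is) = s * t * \<omega> (zs @ map b (insort i (sort is)))"
    if "alternating \<omega>" for \<omega> zs
    using s(2)[OF that, of "zs @ [b i]"] t(2)[OF that, of zs] by simp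
  with s(1) t(1) show ?case
    by (intro bexI[of _ "s * t"]) auto
qed auto

lemma alternating_sort_eq:
  obtains s :: real where "s\<^sup>2 = 1" "\<And>\<omega>. alternating \<omega> \<Longrightarrow> \<omega> (map b is) = s * \<omega> (map b (sort is))"
proof -
  obtain s :: real where "s \<in> {1, -1}"
    "\<And>\<omega> zs. alternating \<omega> \<Longrightarrow> \<omega> (zs @ map b is) = s * \<omega> (zs @ map b (sort is))"
    using alternating_sort[of b "is"] by blast
  from that[of s] this(1) this(2)[of _ "[]"] show ?thesis by auto
qed

text \<open>Increasing index lists are encoded by predicates on \<open>[1..<8]\<close>, which makes
  complementary lists easy to name.\<close>

lemma sorted_sublist_eq_filter:
  assumes "distinct is" "sorted is" "set is \<subseteq> {1..7::nat}"
  shows "is = filter (\<lambda>i. i \<in> set is) [1..<8]"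
  by (rule sorted_distinct_set_unique) (use assms in \<open>auto simp: sorted_wrt_filter\<close>)

lemma form_eq_0I:
  assumes "frame e" "is_form k \<omega>"
    and zero: "\<And>P. length (filter P [1..<8]) = k \<Longrightarrow> \<omega> (map e (filter P [1..<8])) = 0"
  shows "\<omega> = (\<lambda>xs. 0)"
proof
  fix xs
  have alt: "alternating \<omega>" using assms(2) by (rule is_form_alternating)
  \<comment> \<open>A repeated index or a wrong length gives 0 outright; any other list is sorted up
    to sign.\<close>
  have basis: "\<omega> (map e is) = 0" if "set is \<subseteq> {1..7}" for "is"
  proof (cases "distinct is \<and> length is = k")
    case True
    have eq: "sort is = filter (\<lambda>i. i \<in> set (sort is)) [1..<8]"
      using True that by (intro sorted_sublist_eq_filter) auto
    have "length (sort is) = k" using True by simp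
    then have "\<omega> (map e (sort is)) = 0"
      using zero[of "\<lambda>i. i \<in> set (sort is)"] eq by metis
    moreover obtain s :: real where "\<omega> (map e is) = s * \<omega> (map e (sort is))"
      using alternating_sort_eq[of e "is"] alt by metis
    ultimately show ?thesis by simp
  next
    case False
    then show ?thesis
      using alternating_not_distinct[OF alt, of "map e is"] assms(2) by (auto simp: is_form_def distinct_map)
  qed
  \<comment> \<open>The prefix of basis vectors grows as the first remaining argument is expanded in
    the basis.\<close>
  have "\<omega> (map e is @ xs) = 0" if "set is \<subseteq> {1..7}" for "is"
    using that
  proof (induction xs arbitrary: "is")
    case (Cons x xs)
    have lin: "linear (\<lambda>v. \<omega> (map e is @ v # xs))"
      by (rule alternating_linear[OF alt])
    have "\<omega> (map e is @ x # xs) = (\<Sum>i = 1..7. dual_form e i [x] * \<omega> (map e is @ e i # xs))"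
      by (subst frame_expand[OF assms(1), of x]) (simp only: linear_sum[OF lin] linear_scale[OF lin] real_scaleR_def)
    also have "\<dots> = 0"
    proof (intro sum.neutral ballI)
      fix i :: nat assume "i \<in> {1..7}"
      then show "dual_form e i [x] * \<omega> (map e is @ e i # xs) = 0"
        using Cons.IH[of "is @ [i]"] Cons.prems by simp
    qed
    finally show ?case .
  qed (simp add: basis)
  from this[of "[]"] show "\<omega> xs = 0" by simp
qed

lemma coframe_diagonal:
  assumes "frame e" "distinct js" "set js \<subseteq> {1..7}"
  shows "coframe e js (map e js) = 1"
  using assms(2,3)
proof (induction js)
  case (Cons j js)
  have "coframe e (j # js) (map e (j # js)) = interior (e j) (coframe e (j # js)) (map e js)"
    by (simp add: interior_def)
  also have "\<dots> = coframe e js (map e js)"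
    by (subst interior_coframe_hd[OF assms(1)]) (use Cons.prems in auto)
  finally show ?case using Cons by simp
qed (simp add: coframe_Nil)

text \<open>The full list is the only increasing list of length 7, so a 7-form is determined by one
  value.\<close>

lemma top_form_eq:
  assumes "frame e" "is_form 7 \<omega>"
  shows "\<omega> = (\<lambda>xs. \<omega> (map e [1..<8]) * coframe e [1..<8] xs)"
proof -
  let ?r = "\<omega> (map e [1..<8])"
  have diag: "coframe e [1..<8] (map e [1..<8]) = 1"
    by (rule coframe_diagonal[OF assms(1)]) auto
  have "(\<lambda>xs. \<omega> xs - ?r * coframe e [1..<8] xs) = (\<lambda>xs. 0)"
  proof (rule form_eq_0I[OF assms(1), of 7])
    show "is_form 7 (\<lambda>xs. \<omega> xs - ?r * coframe e [1..<8] xs)"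
      using is_form_coframe[OF assms(1), of "[1..<8]"] assms(2) by (intro is_form_diff is_form_scale) simp_all
  next
    fix P
    assume "length (filter P [1..<8::nat]) = 7"
    then have "filter P [1..<8] = [1..<8]"
      using length_filter_less[of _ "[1..<8::nat]" P] by (force simp: filter_id_conv simp del: One_nat_def)
    then show "\<omega> (map e (filter P [1..<8])) - ?r * coframe e [1..<8] (map e (filter P [1..<8])) = 0"
      using diag by (simp del: One_nat_def)
  qed
  then have "\<omega> xs - ?r * coframe e [1..<8] xs = 0" for xs
    by (rule fun_cong)
  then show ?thesis by (intro ext) (rule eq_iff_diff_eq_0[THEN iffD2])
qed


section \<open>Inner products of forms\<close>

text \<open>All tuples, not only the increasing ones: this matches the division by
  \<open>fact k\<close> in \<open>form_inner\<close> and allows splitting off the first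
  index.\<close>

definition multi_indices :: "nat \<Rightarrow> nat list set" where
  "multi_indices k = {is. length is = k \<and> set is \<subseteq> {1..7}}"

lemma sum_multi_indices_Suc:
  "(\<Sum>is\<in>multi_indices (Suc k). f is) = (\<Sum>i = 1..7. \<Sum>is\<in>multi_indices k. f (i # is))"
proof -
  have "multi_indices (Suc k) = (\<lambda>(i, is). i # is) ` ({1..7} \<times> multi_indices k)"
    by (auto simp: multi_indices_def length_Suc_conv image_iff)
  moreover have "inj_on (\<lambda>(i, is). i # is) ({1..7} \<times> multi_indices k)"
    by (auto simp: inj_on_def)
  ultimately show ?thesis
    by (simp add: sum.reindex sum.cartesian_product case_prod_unfold)
qed

lemma multi_indices_0: "multi_indices 0 = {[]}"
  by (auto simp: multi_indices_def)

lemma finite_multi_indices: "finite (multi_indices k)"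
  using finite_lists_length_eq[of "{1..7::nat}" k] by (simp add: multi_indices_def conj_commute)

section \<open>Orthonormal frames and independence of the frame\<close>

lemma orthonormal_coords:
  assumes "bilinear g" "orthonormal_frame g b" "i \<in> {1..7}"
  shows "dual_form b i [x] = g x (b i)"
proof -
  have fr: "frame b" and on: "\<And>i j. i \<in> {1..7} \<Longrightarrow> j \<in> {1..7} \<Longrightarrow> g (b i) (b j) = (if i = j then 1 else 0)"
    using assms(2) by (auto simp: orthonormal_frame_def)
  have lin: "linear (\<lambda>y. g y (b i))" using assms(1) by (simp add: bilinear_def)
  have "g x (b i) = (\<Sum>j = 1..7. dual_form b j [x] * g (b j) (b i))"
    by (subst frame_expand[OF fr, of x]) (simp only: linear_sum[OF lin] linear_scale[OF lin] real_scaleR_def)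
  also have "\<dots> = (\<Sum>j = 1..7. if j = i then dual_form b j [x] else 0)"
    by (rule sum.cong[OF refl]) (use on assms(3) in auto)
  also have "\<dots> = dual_form b i [x]"
    using assms(3) by simp
  finally show ?thesis by simp
qed

lemma orthonormal_parseval:
  assumes "bilinear g" "\<And>x y. g x y = g y x" "orthonormal_frame g b"
  shows "g x y = (\<Sum>i = 1..7. g x (b i) * g y (b i))"
proof -
  have fr: "frame b" using assms(3) by (simp add: orthonormal_frame_def)
  have lin: "linear (g x)" using assms(1) by (simp add: bilinear_def)
  have "g x y = (\<Sum>i = 1..7. dual_form b i [y] * g x (b i))"
    by (subst frame_expand[OF fr, of y]) (simp only: linear_sum[OF lin] linear_scale[OF lin] real_scaleR_def)
  then show ?thesis
    by (simp add: orthonormal_coords[OF assms(1,3)] mult.commute)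
qed

text \<open>Both arguments of \<open>B\<close> are expanded in \<open>e\<close>; summing the
  coefficients over \<open>b\<close> gives \<open>g (e p) (e q)\<close> by Parseval, a Kronecker
  delta.\<close>

lemma orthonormal_trace:
  fixes B :: "'a::real_vector \<Rightarrow> 'a \<Rightarrow> real"
  assumes g: "bilinear g" "\<And>x y. g x y = g y x"
    and b: "orthonormal_frame g b" and e: "orthonormal_frame g e"
    and B: "\<And>x. linear (\<lambda>y. B x y)" "\<And>y. linear (\<lambda>x. B x y)"
  shows "(\<Sum>i = 1..7. B (b i) (b i)) = (\<Sum>i = 1..7. B (e i) (e i))"
proof -
  have fr: "frame e" using e by (simp add: orthonormal_frame_def)
  have eq: "B x y = (\<Sum>p = 1..7. \<Sum>q = 1..7. g x (e p) * g y (e q) * B (e p) (e q))" for x y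
  proof -
    have "B x y = (\<Sum>p = 1..7. dual_form e p [x] * B (e p) y)"
      by (subst frame_expand[OF fr, of x]) (simp only: linear_sum[OF B(2)] linear_scale[OF B(2)] real_scaleR_def)
    moreover have "B z y = (\<Sum>q = 1..7. dual_form e q [y] * B z (e q))" for z
      by (subst frame_expand[OF fr, of y]) (simp only: linear_sum[OF B(1)] linear_scale[OF B(1)] real_scaleR_def)
    ultimately show ?thesis
      by (simp add: orthonormal_coords[OF g(1) e] sum_distrib_left mult.assoc)
  qed
  have "(\<Sum>i = 1..7. B (b i) (b i)) =
      (\<Sum>i = 1..7. \<Sum>p = 1..7. \<Sum>q = 1..7. g (b i) (e p) * g (b i) (e q) * B (e p) (e q))"
    by (subst eq) (rule refl)
  also have "\<dots> = (\<Sum>p = 1..7. \<Sum>i = 1..7. \<Sum>q = 1..7. g (b i) (e p) * g (b i) (e q) * B (e p) (e q))"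
    by (rule sum.swap)
  also have "\<dots> = (\<Sum>p = 1..7. \<Sum>q = 1..7. \<Sum>i = 1..7. g (b i) (e p) * g (b i) (e q) * B (e p) (e q))"
    by (rule sum.cong[OF refl], rule sum.swap)
  also have "\<dots> = (\<Sum>p = 1..7. \<Sum>q = 1..7. (\<Sum>i = 1..7. g (e p) (b i) * g (e q) (b i)) * B (e p) (e q))"
    by (simp add: sum_distrib_right g(2)[of "b _"])
  also have "\<dots> = (\<Sum>p = 1..7. \<Sum>q = 1..7. g (e p) (e q) * B (e p) (e q))"
    by (simp only: orthonormal_parseval[OF g b, symmetric])
  also have "\<dots> = (\<Sum>p = 1..7. \<Sum>q = 1..7. if q = p then B (e p) (e p) else 0)"
    by (intro sum.cong refl) (use e in \<open>auto simp: orthonormal_frame_def\<close>)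
  also have "\<dots> = (\<Sum>p = 1..7. B (e p) (e p))"
    by (intro sum.cong refl) simp
  finally show ?thesis .
qed

text \<open>One slot at a time: the induction hypothesis, applied to contractions, changes the frame
  in the last \<open>k\<close> slots, and the trace identity changes it in the first.\<close>

lemma orthonormal_form_inner:
  assumes g: "bilinear g" "\<And>x y. g x y = g y x"
    and b: "orthonormal_frame g b" and e: "orthonormal_frame g e"
    and "alternating \<alpha>" "alternating \<beta>"
  shows "(\<Sum>is\<in>multi_indices k. \<alpha> (map b is) * \<beta> (map b is)) =
    (\<Sum>is\<in>multi_indices k. \<alpha> (map e is) * \<beta> (map e is))"
  using assms(5,6)
proof (induction k arbitrary: \<alpha> \<beta>)
  case (Suc k)
  have "(\<Sum>is\<in>multi_indices (Suc k). \<alpha> (map b is) * \<beta> (map b is)) =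
      (\<Sum>i = 1..7. \<Sum>is\<in>multi_indices k. interior (b i) \<alpha> (map b is) * interior (b i) \<beta> (map b is))"
    by (simp add: sum_multi_indices_Suc interior_def)
  also have "\<dots> = (\<Sum>i = 1..7. \<Sum>is\<in>multi_indices k. \<alpha> (b i # map e is) * \<beta> (b i # map e is))"
    using Suc by (simp add: alternating_interior) (simp add: interior_def)
  also have "\<dots> = (\<Sum>is\<in>multi_indices k. \<Sum>i = 1..7. \<alpha> (b i # map e is) * \<beta> (b i # map e is))"
    by (rule sum.swap)
  also have "\<dots> = (\<Sum>is\<in>multi_indices k. \<Sum>i = 1..7. \<alpha> (e i # map e is) * \<beta> (e i # map e is))"
  proof (rule sum.cong[OF refl])
    fix "is"
    have lin: "linear (\<lambda>x. c * \<omega> (x # map e is))" if "alternating \<omega>" for \<omega> :: "'a form" and c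
      using linear_compose_scale_right[OF alternating_linear_hd[OF that], of c "map e is"] by simp
    then have lin': "linear (\<lambda>x. \<omega> (x # map e is) * c)" if "alternating \<omega>" for \<omega> :: "'a form" and c
      using that by (simp add: mult.commute)
    show "(\<Sum>i = 1..7. \<alpha> (b i # map e is) * \<beta> (b i # map e is)) = (\<Sum>i = 1..7. \<alpha> (e i # map e is) * \<beta> (e i # map e is))"
      by (rule orthonormal_trace[OF g b e, where B = "\<lambda>x y. \<alpha> (x # map e is) * \<beta> (y # map e is)"])
        (intro lin lin' Suc.prems)+
  qed
  also have "\<dots> = (\<Sum>is\<in>multi_indices (Suc k). \<alpha> (map e is) * \<beta> (map e is))"
    unfolding sum_multi_indices_Suc list.map by (rule sum.swap)
  finally show ?case .
qed (simp add: multi_indices_0)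

text \<open>Independence of the frame makes the definite description meaningful, so any one
  orthonormal frame computes it.\<close>

lemma form_inner_eq:
  assumes g: "inner_product g" and e: "orthonormal_frame g e"
    and "alternating \<alpha>" "alternating \<beta>"
  shows "form_inner g k \<alpha> \<beta> = (\<Sum>is\<in>multi_indices k. \<alpha> (map e is) * \<beta> (map e is)) / fact k"
  unfolding form_inner_def multi_indices_def[symmetric]
proof (rule the_equality)
  show "\<forall>b. orthonormal_frame g b \<longrightarrow> (\<Sum>is\<in>multi_indices k. \<alpha> (map e is) * \<beta> (map e is)) / fact k =
      (\<Sum>is\<in>multi_indices k. \<alpha> (map b is) * \<beta> (map b is)) / fact k"
    using g orthonormal_form_inner[OF _ _ e _ assms(3,4)] by (auto simp: inner_product_def)
qed (use e in blast)

text \<open>Gram's determinant identity in the orthonormal case, obtained from the frame independence of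
  the norm of a top-degree form: in the sum defining that norm, the indices contributing are the
  permutations, and they contribute equally.\<close>

lemma top_form_orthonormal_square:
  assumes g: "inner_product g" and b: "orthonormal_frame g b" and e: "orthonormal_frame g e"
    and "is_form 7 \<omega>"
  shows "(\<omega> (map b [1..<8]))\<^sup>2 = (\<omega> (map e [1..<8]))\<^sup>2"
proof -
  have alt: "alternating \<omega>" using assms(4) by (rule is_form_alternating)
  let ?D = "{is \<in> multi_indices 7. distinct is}"
  have finD: "finite ?D" using finite_multi_indices by simp
  have sum: "(\<Sum>is\<in>multi_indices 7. \<omega> (map f is) * \<omega> (map f is)) = card ?D * (\<omega> (map f [1..<8]))\<^sup>2" for f
  proof -
    have "(\<Sum>is\<in>multi_indices 7. \<omega> (map f is) * \<omega> (map f is)) = (\<Sum>is\<in>?D. \<omega> (map f is) * \<omega> (map f is))"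
      by (rule sum.mono_neutral_right) (auto simp: finite_multi_indices distinct_map alternating_not_distinct[OF alt])
    also have "\<dots> = (\<Sum>is\<in>?D. (\<omega> (map f [1..<8]))\<^sup>2)"
    proof (rule sum.cong[OF refl])
      fix "is" assume "is \<in> ?D"
      then have D: "distinct is" "length is = 7" "set is \<subseteq> {1..7}" by (auto simp: multi_indices_def)
      then have "set is = {1..7}"
        by (intro card_subset_eq) (auto simp: distinct_card)
      moreover have "set [1..<8] = {1..7::nat}" by auto
      ultimately have "sort is = [1..<8]"
        using D(1) by (intro sorted_distinct_set_unique) (simp_all del: One_nat_def upt_rec_numeral)
      moreover obtain s :: real where "s\<^sup>2 = 1" "\<omega> (map f is) = s * \<omega> (map f (sort is))"
        using alternating_sort_eq[of f "is"] alt by metis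
      ultimately show "\<omega> (map f is) * \<omega> (map f is) = (\<omega> (map f [1..<8]))\<^sup>2"
        by (simp add: power2_eq_square[symmetric] power_mult_distrib)
    qed
    finally show ?thesis by simp
  qed
  have "[1..<8] \<in> ?D" by (auto simp: multi_indices_def)
  then have "card ?D \<noteq> 0" using finD by (metis card_0_eq empty_iff)
  moreover have "(\<Sum>is\<in>multi_indices 7. \<omega> (map b is) * \<omega> (map b is)) = (\<Sum>is\<in>multi_indices 7. \<omega> (map e is) * \<omega> (map e is))"
    using g orthonormal_form_inner[OF _ _ b e alt alt] by (simp add: inner_product_def)
  ultimately show ?thesis unfolding sum by simp
qed

text \<open>Only permutations of \<open>js\<close> contribute, and each contributes the same amount,
  since \<alpha> and the coframe pick up the same sign. Hence the inner product with a coframe is a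
  coefficient.\<close>

lemma sum_multi_indices_coframe:
  assumes "frame e" "alternating \<alpha>" "sorted js" "distinct js" "set js \<subseteq> {1..7}"
  shows "(\<Sum>is\<in>multi_indices (length js). \<alpha> (map e is) * coframe e js (map e is)) =
    fact (length js) * \<alpha> (map e js)"
proof -
  let ?P = "permutations_of_set (set js)"
  have len: "length is = length js" if "is \<in> ?P" for "is"
    using that assms(4) by (metis distinct_card permutations_of_setD)
  have "(\<Sum>is\<in>multi_indices (length js). \<alpha> (map e is) * coframe e js (map e is)) =
      (\<Sum>is\<in>?P. \<alpha> (map e is) * coframe e js (map e is))"
  proof (rule sum.mono_neutral_right[OF finite_multi_indices])
    show "?P \<subseteq> multi_indices (length js)"
      using assms(5) len by (auto simp: multi_indices_def dest: permutations_of_setD)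
    show "\<forall>is\<in>multi_indices (length js) - ?P. \<alpha> (map e is) * coframe e js (map e is) = 0"
    proof
      fix "is" assume D: "is \<in> multi_indices (length js) - ?P"
      show "\<alpha> (map e is) * coframe e js (map e is) = 0"
      proof (cases "distinct is")
        case True
        with D have ne: "set is \<noteq> set js" and len: "length is = length js" and sub: "set is \<subseteq> {1..7}"
          by (auto simp: multi_indices_def permutations_of_set_def)
        \<comment> \<open>Both index sets have the same size, so being different they leave some
          index of \<open>js\<close> out of \<open>is\<close>.\<close>
        have "\<not> set js \<subseteq> set is"
          using ne card_subset_eq[of "set is" "set js"] len distinct_card[OF True] distinct_card[OF assms(4)] by auto
        then obtain k where "k \<in> set js" "k \<notin> set is" by blast
        then show ?thesis
          using coframe_vanish[OF assms(1), of k js "is"] assms(5) sub by auto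
      qed (simp add: alternating_not_distinct[OF assms(2)] distinct_map)
    qed
  qed
  also have "\<dots> = (\<Sum>is\<in>?P. \<alpha> (map e js))"
  proof (rule sum.cong[OF refl])
    fix "is" assume "is \<in> ?P"
    then have "sort is = js"
      using assms(3,4) by (intro sorted_distinct_set_unique) (auto dest: permutations_of_setD)
    moreover obtain s where s: "s\<^sup>2 = 1" "\<And>\<omega>. alternating \<omega> \<Longrightarrow> \<omega> (map e is) = s * \<omega> (map e (sort is))"
      using alternating_sort_eq[of e "is"] by blast
    ultimately show "\<alpha> (map e is) * coframe e js (map e is) = \<alpha> (map e js)"
      using s(2)[OF assms(2)] s(2)[OF is_form_alternating[OF is_form_coframe[OF assms(1), of js]]]
        coframe_diagonal[OF assms(1,4,5)]
      by (simp add: power2_eq_square mult.left_commute)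
  qed
  also have "\<dots> = fact (length js) * \<alpha> (map e js)"
    by (simp add: card_permutations_of_set distinct_card[OF assms(4)])
  finally show ?thesis .
qed


section \<open>The Hodge star\<close>

text \<open>Uniqueness: two candidates have the same wedge product with every coframe of degree
  \<open>k\<close>, and the coframe on the complementary indices detects a given
  coefficient.\<close>

lemma hodge_star_eqI:
  fixes e :: "nat \<Rightarrow> 'a::real_vector" and \<eta> \<omega> vol :: "'a form"
  assumes "frame e" "k \<le> 7" "is_form (7 - k) \<eta>"
    and star: "\<And>\<alpha>. is_form k \<alpha> \<Longrightarrow> wedge \<alpha> \<eta> = (\<lambda>xs. form_inner g k \<alpha> \<omega> * vol xs)"
  shows "hodge_star g vol k \<omega> = \<eta>"
  unfolding hodge_star_def
proof (rule the_equality)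
  fix \<eta>'
  assume \<eta>': "is_form (7 - k) \<eta>' \<and>
    (\<forall>\<alpha>. is_form k \<alpha> \<longrightarrow> wedge \<alpha> \<eta>' = (\<lambda>xs. form_inner g k \<alpha> \<omega> * vol xs))"
  have "(\<lambda>xs. \<eta>' xs - \<eta> xs) = (\<lambda>xs. 0)"
  proof (rule form_eq_0I[OF assms(1)])
    show "is_form (7 - k) (\<lambda>xs. \<eta>' xs - \<eta> xs)"
      using \<eta>' assms(3) by (simp add: is_form_diff)
  next
    fix P
    let ?\<alpha> = "coframe e (filter (\<lambda>i. \<not> P i) [1..<8])"
    assume "length (filter P [1..<8::nat]) = 7 - k"
    then have "length (filter (\<lambda>i. \<not> P i) [1..<8]) = k"
      using sum_length_filter_compl[of P "[1..<8]"] assms(2) by simp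
    then have "is_form k ?\<alpha>"
      using is_form_coframe[OF assms(1)] by blast
    then have eq: "wedge ?\<alpha> \<eta>' = wedge ?\<alpha> \<eta>"
      using \<eta>' star by simp
    obtain s where "s \<noteq> 0"
      "\<And>\<eta>. wedge ?\<alpha> \<eta> (map e [1..<8]) = s * \<eta> (map e (filter (\<lambda>i. \<not> \<not> P i) [1..<8]))"
      using wedge_coframe_complement[OF assms(1), of "[1..<8]" "\<lambda>i. \<not> P i"] by fastforce
    then show "\<eta>' (map e (filter P [1..<8])) - \<eta> (map e (filter P [1..<8])) = 0"
      using eq by (metis (mono_tags, lifting) filter_cong mult_left_cancel right_minus_eq)
  qed
  then show "\<eta>' = \<eta>"
    by (metis (no_types) eq_iff_diff_eq_0 ext)
qed (use assms in blast)


section \<open>Uniqueness of the induced metric\<close>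

lemma frame_scale:
  fixes b :: "nat \<Rightarrow> 'a::real_vector"
  assumes "frame b" "t \<noteq> 0"
  shows "frame (\<lambda>i. t *\<^sub>R b i)"
proof -
  let ?f = "\<lambda>v :: 'a. t *\<^sub>R v"
  have img: "(\<lambda>i. t *\<^sub>R b i) ` {1..7} = ?f ` b ` {1..7}"
    by (simp only: image_image)
  have lin: "linear ?f" by (simp add: linear_scale_self)
  have inj: "inj ?f" using assms(2) by (auto intro!: injI)
  have "v = ?f (v /\<^sub>R t)" for v using assms(2) by simp
  then have "surj ?f" by (metis surjI)
  moreover have "inj_on (\<lambda>i. t *\<^sub>R b i) {1..7}"
    using assms by (simp add: frame_def inj_on_def)
  moreover have "independent (?f ` b ` {1..7})"
    using assms(1) lin inj by (intro linear_independent_injective_image) (auto simp: frame_def)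
  moreover have "span (?f ` b ` {1..7}) = ?f ` span (b ` {1..7})"
    by (rule linear_span_image[OF lin])
  ultimately show ?thesis
    using assms(1) unfolding frame_def img by simp
qed

lemma alternating_scale_all:
  assumes "alternating \<omega>"
  shows "\<omega> (zs @ map (\<lambda>i. t *\<^sub>R b i) is) = t ^ length is * \<omega> (zs @ map b is)"
proof (induction "is" arbitrary: zs)
  case (Cons i "is")
  show ?case
    using Cons[of "zs @ [t *\<^sub>R b i]"] linear_scale[OF alternating_linear[OF assms, of zs "map b is"], of t "b i"]
    by simp
qed simp

lemma g2_induces_unique:
  assumes "g2_induces \<phi> g vol" "g2_induces \<phi> g' vol'"
  shows "g = g' \<and> vol = vol'"
proof -
  have g: "inner_product g" and g': "inner_product g'"
    using assms by (auto simp: g2_induces_def)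
  have up: "[1..<8] = [1, 2, 3, 4, 5, 6, 7::nat]" by (simp add: upt_rec)
  obtain b b' where b: "orthonormal_frame g b" "vol = coframe b [1..<8]"
    and b': "orthonormal_frame g' b'" "vol' = coframe b' [1..<8]"
    using assms unfolding g2_induces_def volume_form_def up by blast
  have fr: "frame b" "frame b'"
    using b b' by (auto simp: orthonormal_frame_def)
  have form: "is_form 7 vol" "is_form 7 vol'"
    using is_form_coframe[OF fr(1), of "[1..<8]"] is_form_coframe[OF fr(2), of "[1..<8]"] b(2) b'(2) by auto
  have one: "vol (map b [1..<8]) = 1" "vol' (map b' [1..<8]) = 1"
    unfolding b(2) b'(2) using fr by (auto intro!: coframe_diagonal)
  define s where "s = vol (map b' [1..<8])"
  have vol: "vol xs = s * vol' xs" for xs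
    using top_form_eq[OF fr(2) form(1)] unfolding s_def b'(2) by (rule fun_cong)
  have "6 * g x y * vol xs = 6 * g' x y * vol' xs" for x y xs
    using assms unfolding g2_induces_def by (metis (no_types, lifting))
  \<comment> \<open>On this list \<open>vol'\<close> is 1 and \<open>vol\<close> is
    \<open>s\<close>, so the defining identity compares the two metrics.\<close>
  from this[of _ _ "map b' [1..<8]"] have gg: "g' x y = s * g x y" for x y
    unfolding one s_def[symmetric] by (simp add: mult.commute)
  have "s * g (b' 1) (b' 1) = 1"
    using b'(1) gg[of "b' 1" "b' 1"] by (simp add: orthonormal_frame_def)
  moreover have "g (b' 1) (b' 1) \<ge> 0"
    using g by (metis inner_product_def bilinear_lzero less_eq_real_def)
  ultimately have s: "s > 0"
    by (metis mult_nonpos_nonneg not_le not_one_le_zero zero_less_one)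
  \<comment> \<open>This factor turns the \<open>g\<close>-orthonormal frame \<open>b\<close> into a
    \<open>g'\<close>-orthonormal one.\<close>
  define t where "t = 1 / sqrt s"
  have t: "t\<^sup>2 = 1 / s" "t \<noteq> 0"
    using s by (auto simp: t_def power_divide)
  have bil: "bilinear g'" using g' by (simp add: inner_product_def)
  have "orthonormal_frame g' (\<lambda>i. t *\<^sub>R b i)"
    unfolding orthonormal_frame_def
  proof (intro conjI frame_scale fr t ballI)
    fix i j :: nat assume ij: "i \<in> {1..7}" "j \<in> {1..7}"
    have "g' (t *\<^sub>R b i) (t *\<^sub>R b j) = t\<^sup>2 * (s * g (b i) (b j))"
      unfolding bilinear_lmul[OF bil] bilinear_rmul[OF bil] by (simp add: gg power2_eq_square)
    then show "g' (t *\<^sub>R b i) (t *\<^sub>R b j) = (if i = j then 1 else 0)"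
      using b(1) ij s t by (simp add: orthonormal_frame_def)
  qed
  \<comment> \<open>The rescaled frame may have either orientation, hence the square.\<close>
  then have "(vol' (map (\<lambda>i. t *\<^sub>R b i) [1..<8]))\<^sup>2 = 1"
    using top_form_orthonormal_square[OF g' _ b'(1) form(2)] one by simp
  moreover have "vol' (map (\<lambda>i. t *\<^sub>R b i) [1..<8]) = t ^ 7 * vol' (map b [1..<8])"
    using alternating_scale_all[OF is_form_alternating[OF form(2)], of "[]" t b "[1..<8]"] by simp
  moreover have "vol' (map b [1..<8]) = 1 / s"
    using vol[of "map b [1..<8]"] one(1) s by (simp add: field_simps)
  ultimately have "1 = (t ^ 7 * (1 / s))\<^sup>2" by simp
  also have "\<dots> = (t\<^sup>2) ^ 7 * (1 / s)\<^sup>2"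
    by (simp add: power_divide power_mult[symmetric])
  also have "\<dots> = (1 / s) ^ 9"
    unfolding t(1) by (simp only: power_add[symmetric]) simp
  finally have "s ^ 9 = 1"
    by (simp add: power_divide)
  then have "s = 1"
    using s by (metis power_eq_1_iff zero_neq_numeral abs_of_pos real_norm_def)
  then show ?thesis
    using gg vol by (auto simp: fun_eq_iff)
qed

declare One_nat_def [simp del]

lemma upt_1_8: "[1..<8] = [1, 2, 3, 4, 5, 6, 7::nat]"
  by (simp add: upt_rec)


section \<open>The model form and its dual\<close>

definition g2_model :: "(nat \<Rightarrow> 'a::real_vector) \<Rightarrow> 'a form" where
  "g2_model e xs = coframe e [1, 2, 3] xs + coframe e [1, 4, 5] xs + coframe e [1, 6, 7] xs
     + coframe e [2, 4, 6] xs - coframe e [2, 5, 7] xs - coframe e [3, 4, 7] xs - coframe e [3, 5, 6] xs"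

definition g2_model_dual :: "(nat \<Rightarrow> 'a::real_vector) \<Rightarrow> 'a form" where
  "g2_model_dual e xs = coframe e [4, 5, 6, 7] xs + coframe e [2, 3, 6, 7] xs + coframe e [2, 3, 4, 5] xs
     + coframe e [1, 3, 5, 7] xs - coframe e [1, 3, 4, 6] xs - coframe e [1, 2, 5, 6] xs
     - coframe e [1, 2, 4, 7] xs"

definition frame_metric :: "(nat \<Rightarrow> 'a::real_vector) \<Rightarrow> 'a \<Rightarrow> 'a \<Rightarrow> real" where
  "frame_metric e x y = (\<Sum>i = 1..7. dual_form e i [x] * dual_form e i [y])"

lemma is_form_g2_model:
  assumes "frame e"
  shows "is_form 3 (g2_model e)" "is_form 4 (g2_model_dual e)"
proof -
  have c: "is_form 3 (coframe e [i, j, k])" "is_form 4 (coframe e [i, j, k, l])" for i j k l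
    using is_form_coframe[OF assms, of "[i, j, k]"] is_form_coframe[OF assms, of "[i, j, k, l]"]
    by (simp_all add: numeral_eq_Suc)
  show "is_form 3 (g2_model e)" "is_form 4 (g2_model_dual e)"
    unfolding g2_model_def [abs_def] g2_model_dual_def [abs_def]
    by (intro is_form_add is_form_diff c)+
qed

lemma inner_product_frame_metric:
  assumes "frame e"
  shows "inner_product (frame_metric e)"
  unfolding inner_product_def
proof (intro conjI allI impI)
  note lin = linear_dual_form[OF assms]
  show "bilinear (frame_metric e)"
    unfolding bilinear_def frame_metric_def
    by (intro conjI allI linear_compose_sum ballI)
      (simp_all add: linear_iff linear_add[OF lin] linear_scale[OF lin] distrib_left distrib_right)
  show "frame_metric e x y = frame_metric e y x" for x y
    by (simp add: frame_metric_def mult.commute)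
  fix x :: 'a assume "x \<noteq> 0"
  then obtain i where "i \<in> {1..7}" "dual_form e i [x] \<noteq> 0"
    using frame_expand[OF assms, of x] by (metis (no_types, lifting) scaleR_eq_0_iff sum.neutral)
  then show "frame_metric e x x > 0"
    unfolding frame_metric_def by (intro sum_pos2[of _ i]) (auto simp: zero_less_mult_iff neq_iff)
qed

lemma orthonormal_frame_metric:
  assumes "frame e"
  shows "orthonormal_frame (frame_metric e) e"
  unfolding orthonormal_frame_def
proof (intro conjI assms ballI)
  fix i j :: nat assume ij: "i \<in> {1..7}" "j \<in> {1..7}"
  have "frame_metric e (e i) (e j) = (\<Sum>k = 1..7. if k = i then (if i = j then 1 else 0) else 0)"
    unfolding frame_metric_def by (rule sum.cong[OF refl]) (use ij dual_form_basis[OF assms] in auto)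
  then show "frame_metric e (e i) (e j) = (if i = j then 1 else 0)"
    using ij by simp
qed

lemma coframe_3:
  "coframe e [i, j, k] [x, y, z] =
    dual_form e i [x] * (dual_form e j [y] * dual_form e k [z] - dual_form e j [z] * dual_form e k [y])
    - dual_form e i [y] * (dual_form e j [x] * dual_form e k [z] - dual_form e j [z] * dual_form e k [x])
    + dual_form e i [z] * (dual_form e j [x] * dual_form e k [y] - dual_form e j [y] * dual_form e k [x])"
  by (simp add: coframe_Cons coframe_Nil wedge_dual_form_Cons interior_apply)

lemma coframe_4:
  "coframe e [i, j, k, l] [w, x, y, z] =
    dual_form e i [w] * coframe e [j, k, l] [x, y, z] - dual_form e i [x] * coframe e [j, k, l] [w, y, z]
    + dual_form e i [y] * coframe e [j, k, l] [w, x, z] - dual_form e i [z] * coframe e [j, k, l] [w, x, y]"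
  by (simp add: coframe_Cons[of e i] wedge_dual_form_Cons interior_apply)

text \<open>The six terms are the (2,2)-shuffles; every other split gives a factor the wrong number
  of arguments.\<close>

lemma wedge_2_2:
  assumes "is_form 2 \<alpha>" "is_form 2 \<beta>"
  shows "wedge \<alpha> \<beta> [w, x, y, z] =
    \<alpha> [w, x] * \<beta> [y, z] - \<alpha> [w, y] * \<beta> [x, z] + \<alpha> [w, z] * \<beta> [x, y]
    + \<alpha> [x, y] * \<beta> [w, z] - \<alpha> [x, z] * \<beta> [w, y] + \<alpha> [y, z] * \<beta> [w, x]"
proof -
  have zero: "\<omega> [] = 0" "\<omega> [p] = 0" "\<omega> [p, q, r] = 0" "\<omega> [p, q, r, t] = 0"
    if "is_form 2 \<omega>" for \<omega> :: "'a form" and p q r t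
    using that by (simp_all add: is_form_def)
  show ?thesis
    by (simp add: wedge_Cons interior_apply grade_inv_def zero[OF assms(1)] zero[OF assms(2)])
qed

lemma wedge_coframe_skip_map:
  assumes "frame e" "j \<in> {1..7}" "set is \<subseteq> {1..7}" "j \<notin> set is"
  shows "wedge \<alpha> (coframe e is) (map e (j # js)) = wedge (interior (e j) \<alpha>) (coframe e is) (map e js)"
  using wedge_coframe_skip(2)[OF assms] by simp

text \<open>Each summand takes its own indices and leaves the complementary ones to \<alpha>. The
  surviving lists and signs are those of the dual form in the first case and of the model form in
  the second.\<close>

lemma wedge_g2_model_right:
  assumes "frame e"
  shows "wedge \<alpha> (g2_model e) (map e [1..<8]) =
      \<alpha> (map e [4, 5, 6, 7]) + \<alpha> (map e [2, 3, 6, 7]) + \<alpha> (map e [2, 3, 4, 5])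
      + \<alpha> (map e [1, 3, 5, 7]) - \<alpha> (map e [1, 3, 4, 6]) - \<alpha> (map e [1, 2, 5, 6]) - \<alpha> (map e [1, 2, 4, 7])"
    and "wedge \<alpha> (g2_model_dual e) (map e [1..<8]) =
      \<alpha> (map e [1, 2, 3]) + \<alpha> (map e [1, 4, 5]) + \<alpha> (map e [1, 6, 7]) + \<alpha> (map e [2, 4, 6])
      - \<alpha> (map e [2, 5, 7]) - \<alpha> (map e [3, 4, 7]) - \<alpha> (map e [3, 5, 6])"
  unfolding g2_model_def [abs_def] g2_model_dual_def [abs_def] upt_1_8 wedge_add_right wedge_diff_right
  by (simp_all del: list.map
      add: wedge_coframe_skip_map[OF assms] wedge_coframe_take(2)[OF assms] coframe_Nil wedge_unit_right)
    (simp_all add: interior_apply grade_inv_def)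

text \<open>The table of the seven-dimensional cross product. Each pair of indices lies in exactly
  one of the seven triples of the model form (the lines of the Fano plane), so a single coordinate
  survives.\<close>

lemma g2_model_contraction:
  assumes "frame e"
  shows "g2_model e [x, e 1, e 2] = dual_form e 3 [x]" "g2_model e [x, e 1, e 3] = - dual_form e 2 [x]"
    "g2_model e [x, e 1, e 4] = dual_form e 5 [x]" "g2_model e [x, e 1, e 5] = - dual_form e 4 [x]"
    "g2_model e [x, e 1, e 6] = dual_form e 7 [x]" "g2_model e [x, e 1, e 7] = - dual_form e 6 [x]"
    "g2_model e [x, e 2, e 3] = dual_form e 1 [x]" "g2_model e [x, e 2, e 4] = dual_form e 6 [x]"
    "g2_model e [x, e 2, e 5] = - dual_form e 7 [x]" "g2_model e [x, e 2, e 6] = - dual_form e 4 [x]"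
    "g2_model e [x, e 2, e 7] = dual_form e 5 [x]" "g2_model e [x, e 3, e 4] = - dual_form e 7 [x]"
    "g2_model e [x, e 3, e 5] = - dual_form e 6 [x]" "g2_model e [x, e 3, e 6] = dual_form e 5 [x]"
    "g2_model e [x, e 3, e 7] = dual_form e 4 [x]" "g2_model e [x, e 4, e 5] = dual_form e 1 [x]"
    "g2_model e [x, e 4, e 6] = dual_form e 2 [x]" "g2_model e [x, e 4, e 7] = - dual_form e 3 [x]"
    "g2_model e [x, e 5, e 6] = - dual_form e 3 [x]" "g2_model e [x, e 5, e 7] = - dual_form e 2 [x]"
    "g2_model e [x, e 6, e 7] = dual_form e 1 [x]"
  by (simp_all add: g2_model_def coframe_3 dual_form_basis[OF assms])

lemma sum_1_7: "(\<Sum>i = 1..7. f i) = f 1 + (f 2 + (f 3 + (f 4 + (f 5 + (f 6 + f (7::nat))))))"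
  for f :: "nat \<Rightarrow> real"
proof -
  have "{1..7} = {1, 2, 3, 4, 5, 6, 7::nat}" by auto
  then show ?thesis by simp
qed

lemma g2_induces_model:
  assumes "frame e"
  shows "g2_induces (g2_model e) (frame_metric e) (coframe e [1..<8])"
  unfolding g2_induces_def
proof (intro conjI allI inner_product_frame_metric[OF assms])
  show "volume_form (frame_metric e) (coframe e [1..<8])"
    using orthonormal_frame_metric[OF assms] by (auto simp: volume_form_def upt_1_8)
  fix x y
  let ?\<alpha> = "interior x (g2_model e)" and ?\<beta> = "interior y (g2_model e)"
  have form2: "is_form 2 ?\<alpha>" "is_form 2 ?\<beta>"
    using is_form_interior[of 2] is_form_g2_model(1)[OF assms] by (simp_all add: numeral_eq_Suc)
  \<comment> \<open>Each of the seven quadruples contributes twice the products of the coordinates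
    of \<open>x\<close> and \<open>y\<close> over the complementary triple. Every index lies in
    three triples, which gives the factor 6.\<close>
  have "wedge (wedge ?\<alpha> ?\<beta>) (g2_model e) (map e [1..<8]) = 6 * frame_metric e x y"
    unfolding wedge_g2_model_right[OF assms]
    by (simp add: wedge_2_2[OF form2] interior_apply g2_model_contraction[OF assms] frame_metric_def
        sum_1_7 algebra_simps)
  moreover have "is_form 7 (wedge (wedge ?\<alpha> ?\<beta>) (g2_model e))"
    using is_form_wedge[OF is_form_wedge[OF form2] is_form_g2_model(1)[OF assms]] by simp
  ultimately show "wedge (wedge ?\<alpha> ?\<beta>) (g2_model e) = (\<lambda>xs. 6 * frame_metric e x y * coframe e [1..<8] xs)"
    using top_form_eq[OF assms] by metis
qed

lemma hodge_star_g2_model: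
  assumes "frame e"
  shows "hodge_star (frame_metric e) (coframe e [1..<8]) 3 (g2_model e) = g2_model_dual e"
proof (rule hodge_star_eqI[OF assms])
  show "is_form (7 - 3) (g2_model_dual e)"
    using is_form_g2_model(2)[OF assms] by simp
  fix \<alpha> :: "'a form" assume \<alpha>: "is_form 3 \<alpha>"
  have alt: "alternating \<alpha>" "alternating (g2_model e)"
    using \<alpha> is_form_g2_model(1)[OF assms] by (auto intro: is_form_alternating)
  \<comment> \<open>The factor 6 is \<open>fact 3\<close> and cancels the normalization in
    \<open>form_inner\<close>.\<close>
  have sum: "(\<Sum>is\<in>multi_indices 3. \<alpha> (map e is) * coframe e [i, j, k] (map e is)) = 6 * \<alpha> (map e [i, j, k])"
    if "i < j" "j < k" "{i, j, k} \<subseteq> {1..7}" for i j k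
    using sum_multi_indices_coframe[OF assms alt(1), of "[i, j, k]"] that
    by (simp add: numeral_eq_Suc)
  have "form_inner (frame_metric e) 3 \<alpha> (g2_model e) = wedge \<alpha> (g2_model_dual e) (map e [1..<8])"
    unfolding form_inner_eq[OF inner_product_frame_metric[OF assms] orthonormal_frame_metric[OF assms] alt]
      g2_model_def distrib_left right_diff_distrib sum.distrib sum_subtractf wedge_g2_model_right[OF assms]
    by (simp add: sum fact_numeral del: list.map)
  moreover have "is_form 7 (wedge \<alpha> (g2_model_dual e))"
    using is_form_wedge[OF \<alpha> is_form_g2_model(2)[OF assms]] by simp
  ultimately show "wedge \<alpha> (g2_model_dual e) =
      (\<lambda>xs. form_inner (frame_metric e) 3 \<alpha> (g2_model e) * coframe e [1..<8] xs)"
    using top_form_eq[OF assms] by metis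
qed simp

text \<open>Uniqueness of the induced pair resolves the definite descriptions of metric and
  volume.\<close>

lemma coclosed_g2_model_iff:
  assumes "frame e"
  shows "coclosed br (g2_model e) \<longleftrightarrow> ce_diff br (g2_model_dual e) = (\<lambda>xs. 0)"
proof -
  note ind = g2_induces_model[OF assms]
  have "g2_metric (g2_model e) = frame_metric e"
    unfolding g2_metric_def using ind g2_induces_unique[OF _ ind] by (intro the_equality) blast+
  moreover have "g2_volume (g2_model e) = coframe e [1..<8]"
    unfolding g2_volume_def using ind g2_induces_unique[OF _ ind] by (intro the_equality) blast+
  moreover have "g2_structure (g2_model e)"
    using ind is_form_g2_model(1)[OF assms] by (auto simp: g2_structure_def)
  ultimately show ?thesis
    by (simp add: coclosed_def hodge_star_g2_model[OF assms])
qed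


section \<open>The Chevalley--Eilenberg differential\<close>

text \<open>The derivation induced by \<open>br x\<close>. Contraction keeps the passed arguments in
  front, so the bracket replaces its argument in place and no signs occur.\<close>

fun bracket_insert :: "('a \<Rightarrow> 'a \<Rightarrow> 'a) \<Rightarrow> 'a \<Rightarrow> 'a form \<Rightarrow> 'a form" where
  "bracket_insert br x \<omega> [] = 0"
| "bracket_insert br x \<omega> (y # ys) = \<omega> (br x y # ys) + bracket_insert br x (interior y \<omega>) ys"

text \<open>The sign \<open>(-1) ^ j\<close> is the cost of moving the bracket from the front back
  to slot \<open>j\<close>.\<close>

lemma bracket_insert_eq_sum:
  assumes "alternating \<omega>"
  shows "(\<Sum>j<length xs. (-1) ^ j * \<omega> (br x (xs ! j) # nths xs (- {j}))) = bracket_insert br x \<omega> xs"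
  using assms
proof (induction xs arbitrary: \<omega>)
  case (Cons y ys)
  have eq: "nths (y # ys) (- {0}) = ys" "nths (y # ys) (- {Suc j}) = y # nths ys (- {j})" for j
    by (simp_all add: nths_Cons Compl_eq nths_all)
  have "(\<Sum>j<length (y # ys). (-1) ^ j * \<omega> (br x ((y # ys) ! j) # nths (y # ys) (- {j}))) =
      \<omega> (br x y # ys) - (\<Sum>j<length ys. (-1) ^ j * \<omega> (br x (ys ! j) # y # nths ys (- {j})))"
    by (simp add: sum.lessThan_Suc_shift eq sum_negf del: sum.lessThan_Suc)
  also have "\<dots> = \<omega> (br x y # ys) + (\<Sum>j<length ys. (-1) ^ j * interior y \<omega> (br x (ys ! j) # nths ys (- {j})))"
    by (simp add: alternating_swap_hd[OF Cons.prems, of _ y] interior_apply sum_negf)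
  also have "\<dots> = bracket_insert br x \<omega> (y # ys)"
    using Cons by (simp add: alternating_interior)
  finally show ?case .
qed simp

lemma ce_diff_Nil: "ce_diff br \<omega> [] = 0"
  by (simp add: ce_diff_def)

text \<open>Cartan's formula \<open>\<iota>\<^sub>x d = L\<^sub>x - d \<iota>\<^sub>x\<close>, the Lie derivative \<open>L\<^sub>x\<close> being \<open>- bracket_insert br x\<close>.\<close>

lemma ce_diff_Cons:
  assumes "alternating \<omega>"
  shows "ce_diff br \<omega> (x # xs) = - bracket_insert br x \<omega> xs - ce_diff br (interior x \<omega>) xs"
proof -
  let ?n = "length xs"
  let ?t = "\<lambda>(i, j). (-1) ^ (i + j) * \<omega> (br ((x # xs) ! i) ((x # xs) ! j) # nths (x # xs) (- {i, j}))"
  let ?P = "\<lambda>n. {(i, j). i < j \<and> j < n}"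
  have finP: "finite (?P n)" for n :: nat
    by (rule finite_subset[of _ "{..<n} \<times> {..<n}"]) auto
  have split: "?P (Suc ?n) = (\<lambda>j. (0, Suc j)) ` {..<?n} \<union> map_prod Suc Suc ` ?P ?n"
    by (auto simp: image_iff less_Suc_eq_0_disj)
  have inj: "inj_on (map_prod Suc Suc) A" "inj_on (\<lambda>j. (0::nat, Suc j)) B" for A B
    by (auto simp: inj_on_def)
  have eq0: "nths (x # xs) (- {0, Suc j}) = nths xs (- {j})" for j
    by (simp add: nths_Cons Compl_eq)
  have eq1: "nths (x # xs) (- {Suc i, Suc j}) = x # nths xs (- {i, j})" for i j
    by (simp add: nths_Cons Compl_eq)
  have "ce_diff br \<omega> (x # xs) = sum ?t (?P (Suc ?n))"
    by (simp add: ce_diff_def)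
  also have "\<dots> = sum ?t ((\<lambda>j. (0, Suc j)) ` {..<?n}) + sum ?t (map_prod Suc Suc ` ?P ?n)"
    unfolding split by (rule sum.union_disjoint) (use finP in auto)
  also have "sum ?t ((\<lambda>j. (0, Suc j)) ` {..<?n}) = - bracket_insert br x \<omega> xs"
    by (simp add: sum.reindex[OF inj(2)] eq0 sum_negf bracket_insert_eq_sum[OF assms, symmetric])
  also have "sum ?t (map_prod Suc Suc ` ?P ?n) = - ce_diff br (interior x \<omega>) xs"
    unfolding ce_diff_def sum.reindex[OF inj(1)] sum_negf[symmetric]
    by (rule sum.cong[OF refl])
      (auto simp: eq1 interior_apply alternating_swap_hd[OF assms, of _ x])
  finally show ?thesis by simp
qed

section \<open>The differential of a form is again a form\<close>

lemma linear_ce_diff: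
  assumes "\<And>zs. linear (\<lambda>v. F v zs)"
  shows "linear (\<lambda>v. ce_diff br (F v) zs)"
  unfolding ce_diff_def
  by (rule linear_compose_sum)
    (auto simp: linear_iff algebra_simps linear_add[OF assms] linear_scale[OF assms])

lemma linear_bracket_insert:
  assumes "\<And>zs. linear (\<lambda>v. F v zs)"
  shows "linear (\<lambda>v. bracket_insert br x (F v) zs)"
  using assms
proof (induction zs arbitrary: F)
  case (Cons z zs)
  show ?case
    by (simp, intro linear_compose_add Cons) (simp add: interior_def Cons.prems)
qed (simp add: linear_zero)

context
  fixes br :: "'a::real_vector \<Rightarrow> 'a \<Rightarrow> 'a"
  assumes bil: "bilinear br"
begin

lemma linear_bracket_insert_left:
  assumes "alternating \<omega>"
  shows "linear (\<lambda>v. bracket_insert br v \<omega> zs)"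
  using assms
proof (induction zs arbitrary: \<omega>)
  case (Cons z zs)
  have "linear (\<lambda>v. br v z)" using bil by (simp add: bilinear_def)
  from linear_compose[OF this alternating_linear_hd[OF Cons.prems, of zs]]
  show ?case
    using Cons by (simp add: o_def linear_compose_add alternating_interior)
qed (simp add: linear_zero)

lemma linear_bracket_insert_arg:
  assumes "alternating \<omega>"
  shows "linear (\<lambda>v. bracket_insert br x \<omega> (xs @ v # ys))"
  using assms
proof (induction xs arbitrary: \<omega>)
  case Nil
  have "linear (br x)" using bil by (simp add: bilinear_def)
  from linear_compose[OF this alternating_linear_hd[OF Nil, of ys]]
  show ?case
    by (auto simp: o_def interior_def intro!: linear_compose_add linear_bracket_insert alternating_linear_hd Nil)
next
  case (Cons z zs)
  then show ?case
    using alternating_linear[OF Cons.prems, of "br x z # zs" ys]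
    by (simp add: linear_compose_add alternating_interior)
qed

text \<open>The terms with the bracket in the first and in the second of the two equal slots cancel
  by a swap; all others keep the repetition.\<close>

lemma bracket_insert_repeat:
  assumes "alternating \<omega>"
  shows "bracket_insert br x \<omega> (xs @ v # v # ys) = 0"
  using assms
proof (induction xs arbitrary: \<omega>)
  case Nil
  have "interior v (interior v \<omega>) = (\<lambda>zs. 0)"
    using alternating_repeat[OF Nil, of "[]"] by (auto simp: interior_def)
  moreover have "interior y (\<lambda>zs. 0 :: real) = (\<lambda>zs. 0)" for y :: 'a
    by (simp add: interior_def fun_eq_iff)
  then have "bracket_insert br x (\<lambda>zs. 0) ys = 0" for ys
    by (induction ys) simp_all
  ultimately show ?case
    using alternating_swap_hd[OF Nil, of "br x v" v ys] by (simp add: interior_apply)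
next
  case (Cons z zs)
  then show ?case
    using alternating_repeat[OF Cons.prems, of "br x z # zs"] by (simp add: alternating_interior)
qed

lemma alternating_ce_diff:
  assumes "\<And>x. br x x = 0" "alternating \<omega>"
  shows "alternating (ce_diff br \<omega>)"
  unfolding alternating_def
proof (intro conjI allI)
  fix xs ys
  show "linear (\<lambda>v. ce_diff br \<omega> (xs @ v # ys))"
    using assms(2)
  proof (induction xs arbitrary: \<omega>)
    case Nil
    have "linear (\<lambda>v. ce_diff br (interior v \<omega>) ys)"
      by (rule linear_ce_diff) (simp add: interior_def alternating_linear_hd[OF Nil])
    then show ?case
      by (simp add: ce_diff_Cons[OF Nil] linear_compose_sub linear_compose_neg linear_bracket_insert_left[OF Nil])
  next
    case (Cons x xs)
    then show ?case
      by (simp add: ce_diff_Cons[OF Cons.prems] linear_compose_sub linear_compose_neg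
          linear_bracket_insert_arg alternating_interior)
  qed
next
  fix xs v ys
  show "ce_diff br \<omega> (xs @ v # v # ys) = 0"
    using assms(2)
  proof (induction xs arbitrary: \<omega>)
    case Nil
    have "interior v (interior v \<omega>) = (\<lambda>zs. 0)"
      using alternating_repeat[OF Nil, of "[]"] by (auto simp: interior_def)
    moreover have "ce_diff br (\<lambda>zs. 0) ys = 0"
      by (simp add: ce_diff_def)
    moreover have "\<omega> (0 # ys) = 0"
      using linear_0[OF alternating_linear_hd[OF Nil]] .
    \<comment> \<open>Applying Cartan's formula twice, the two \<open>bracket_insert\<close> terms
      of the contraction by \<open>v\<close> cancel; what remains involves only
      \<open>br v v\<close> or a double contraction.\<close>
    ultimately show ?case
      by (simp add: ce_diff_Cons Nil alternating_interior assms(1))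
  next
    case (Cons x xs)
    then show ?case
      by (simp add: ce_diff_Cons bracket_insert_repeat alternating_interior)
  qed
qed

lemma is_form_ce_diff:
  assumes "\<And>x. br x x = 0" "is_form k \<omega>"
  shows "is_form (Suc k) (ce_diff br \<omega>)"
  unfolding is_form_iff
proof (intro conjI allI impI alternating_ce_diff assms is_form_alternating[OF assms(2)])
  fix xs :: "'a list"
  assume len: "length xs \<noteq> Suc k"
  have "length (nths xs (- {i, j})) = length xs - 2" if "i < j" "j < length xs" for i j
  proof -
    have "{p. p < length xs \<and> p \<in> - {i, j}} = {..<length xs} - {i, j}" by auto
    then show ?thesis using that by (simp add: length_nths card_Diff_subset)
  qed
  then have "\<omega> (br (xs ! i) (xs ! j) # nths xs (- {i, j})) = 0" if "i < j" "j < length xs" for i j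
    using assms(2) len that by (simp add: is_form_def)
  then show "ce_diff br \<omega> xs = 0"
    by (auto simp: ce_diff_def intro!: sum.neutral)
qed

end


section \<open>Coclosedness\<close>

text \<open>Replaces the quantification over predicates in \<open>form_eq_0I\<close> by a finite
  list of index lists.\<close>

lemma filter_in_subseqs: "filter P xs \<in> set (subseqs xs)"
  by (induction xs) (auto simp: Let_def)

lemma subseqs_1_7_length_5:
  "filter (\<lambda>is. length is = 5) (subseqs [1, 2, 3, 4, 5, 6, 7 :: nat]) =
     [[1, 2, 3, 4, 5], [1, 2, 3, 4, 6], [1, 2, 3, 4, 7], [1, 2, 3, 5, 6], [1, 2, 3, 5, 7], [1,
      2, 3, 6, 7], [1, 2, 4, 5, 6], [1, 2, 4, 5, 7], [1, 2, 4, 6, 7], [1, 2, 5, 6, 7], [1, 3, 4,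
      5, 6], [1, 3, 4, 5, 7], [1, 3, 4, 6, 7], [1, 3, 5, 6, 7], [1, 4, 5, 6, 7], [2, 3, 4, 5,
      6], [2, 3, 4, 5, 7], [2, 3, 4, 6, 7], [2, 3, 5, 6, 7], [2, 4, 5, 6, 7], [3, 4, 5, 6, 7]]"
  by code_simp

lemma alternating_arg_simps:
  assumes "alternating \<omega>"
  shows "\<omega> (xs @ 0 # ys) = 0" "\<omega> (xs @ (t *\<^sub>R v) # ys) = t * \<omega> (xs @ v # ys)"
    "\<omega> (xs @ (- v) # ys) = - \<omega> (xs @ v # ys)"
  using linear_0[OF alternating_linear[OF assms]] linear_scale[OF alternating_linear[OF assms]]
    linear_neg[OF alternating_linear[OF assms]] by simp_all

lemma ce_diff_5:
  assumes "alternating \<omega>"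
  shows "ce_diff br \<omega> [v, w, x, y, z] =
    - (\<omega> [br v w, x, y, z] + \<omega> [w, br v x, y, z] + \<omega> [w, x, br v y, z] + \<omega> [w, x, y, br v z])
    + (\<omega> [v, br w x, y, z] + \<omega> [v, x, br w y, z] + \<omega> [v, x, y, br w z])
    - (\<omega> [v, w, br x y, z] + \<omega> [v, w, y, br x z]) + \<omega> [v, w, x, br y z]"
  by (simp add: ce_diff_Cons ce_diff_Nil alternating_interior assms interior_apply)

lemma ce_diff_g2_model_dual:
  assumes "lie_algebra_g a b c d br e"
  shows "ce_diff br (g2_model_dual e) = (\<lambda>xs. 0) \<longleftrightarrow> c = - d"
proof -
  let ?\<psi> = "g2_model_dual e"
  have fr: "frame e" and bil: "bilinear br" and alt: "\<And>x. br x x = 0"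
    using assms by (auto simp: lie_algebra_g_def lie_algebra_def)
  have br: "br (e 1) (e 4) = a *\<^sub>R e 5" "br (e 1) (e 5) = - a *\<^sub>R e 4"
    "br (e 1) (e 6) = b *\<^sub>R e 7" "br (e 1) (e 7) = - b *\<^sub>R e 6"
    "br (e 2) (e 4) = c *\<^sub>R e 5" "br (e 2) (e 5) = - c *\<^sub>R e 4"
    "br (e 2) (e 6) = d *\<^sub>R e 7" "br (e 2) (e 7) = - d *\<^sub>R e 6"
    using assms by (simp_all only: lie_algebra_g_def)
  \<comment> \<open>Brackets with \<open>i < j\<close> suffice, because the differential is only
    evaluated on increasing lists.\<close>
  have br0: "br (e i) (e j) = 0" if "i \<in> {1..7}" "j \<in> {1..7}" "i < j" "(i, j) \<notin> {1, 2} \<times> {4..7}" for i j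
  proof -
    have "\<forall>i\<in>{1..7}. \<forall>j\<in>{1..7}. i < j \<and> (i, j) \<notin> {1, 2} \<times> {4..7} \<longrightarrow> br (e i) (e j) = 0"
      using assms unfolding lie_algebra_g_def by (elim conjE)
    then show ?thesis using that by blast
  qed
  have form: "is_form 4 ?\<psi>" by (rule is_form_g2_model(2)[OF fr])
  have alt\<psi>: "alternating ?\<psi>" using form by (rule is_form_alternating)
  note lin = alternating_arg_simps[OF alt\<psi>, of "[]", simplified] alternating_arg_simps[OF alt\<psi>, of "[x]" for x, simplified]
    alternating_arg_simps[OF alt\<psi>, of "[x, y]" for x y, simplified]
    alternating_arg_simps[OF alt\<psi>, of "[x, y, z]" for x y z, simplified]
  note expand = ce_diff_5[OF alt\<psi>] br br0 lin
  have "\<forall>i\<in>{1, 2, 3, 4, 5, 6, 7}. \<forall>j\<in>{1, 2, 3, 4, 5, 6, 7}. dual_form e i [e j] = (if i = j then 1 else 0)"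
    using dual_form_basis[OF fr] by simp
  note dual_table = this[simplified]
  note eval = g2_model_dual_def coframe_4 coframe_3 dual_table
  show ?thesis
  proof
    assume "ce_diff br ?\<psi> = (\<lambda>xs. 0)"
    \<comment> \<open>This coefficient is \<open>c + d\<close>: bracketing \<open>e 2\<close> with
      \<open>e 4\<close> gives \<open>c\<close> from the term
      \<open>e\<^sup>1\<^sup>3\<^sup>5\<^sup>7\<close>, and with \<open>e 7\<close> gives
      \<open>d\<close> from the term \<open>- e\<^sup>1\<^sup>3\<^sup>4\<^sup>6\<close>.\<close>
    then have "ce_diff br ?\<psi> (map e [1, 2, 3, 4, 7]) = 0" by simp
    then have "c + d = 0"
      by (simp add: expand) (simp add: eval)
    then show "c = - d" by simp
  next
    assume cd: "c = - d"
    have "\<forall>is\<in>set (filter (\<lambda>is. length is = 5) (subseqs [1..<8])). ce_diff br ?\<psi> (map e is) = 0"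
      \<comment> \<open>Brackets and scalars are resolved first, leaving values of \<psi> at basis
        vectors; only then are these expanded as determinants.\<close>
      unfolding upt_1_8 subseqs_1_7_length_5 by (simp add: expand) (simp add: eval cd)
    then show "ce_diff br ?\<psi> = (\<lambda>xs. 0)"
      using is_form_ce_diff[OF bil alt form] by (intro form_eq_0I[OF fr, of 5]) (auto simp: filter_in_subseqs)
  qed
qed

theorem proposition4p6:
  fixes a b c d :: real
    and br :: "'a::real_vector \<Rightarrow> 'a \<Rightarrow> 'a"
    and e :: "nat \<Rightarrow> 'a"
    and \<phi> :: "'a form"
  assumes "a\<^sup>2 + c\<^sup>2 \<noteq> 0" and "b\<^sup>2 + d\<^sup>2 \<noteq> 0" and "a * d - b * c \<noteq> 0"
    and "lie_algebra_g a b c d br e"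
    and "\<phi> = (\<lambda>xs. coframe e [1, 2, 3] xs + coframe e [1, 4, 5] xs + coframe e [1, 6, 7] xs
               + coframe e [2, 4, 6] xs - coframe e [2, 5, 7] xs
               - coframe e [3, 4, 7] xs - coframe e [3, 5, 6] xs)"
  shows "coclosed br \<phi> \<longleftrightarrow> c = - d"
proof -
  have "\<phi> = g2_model e"
    unfolding assms(5) g2_model_def [abs_def] ..
  moreover have "frame e"
    using assms(4) by (simp add: lie_algebra_g_def)
  ultimately show ?thesis
    by (simp only: coclosed_g2_model_iff ce_diff_g2_model_dual[OF assms(4)])
qed

end
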